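(* Let $(A,B,P)$ be an $\mathbb E$-contraction on a Hilbert space $\mathcal H$. Let $\mathcal H_1$ be the maximal subspace of $\mathcal H$ which reduces $P$ and on which $P$ is unitary. Let $\mathcal H_2=\mathcal H\ominus\mathcal H_1$. Then $\mathcal H_1$ and $\mathcal H_2$ reduce $A$ and $B$; the triple $(A|_{\mathcal H_1},B|_{\mathcal H_1},P|_{\mathcal H_1})$ is an $\mathbb E$-unitary, and $(A|_{\mathcal H_2},B|_{\mathcal H_2},P|_{\mathcal H_2})$ is a completely non-unitary $\mathbb E$-contraction. (Either of the subspaces $\mathcal H_1$, $\mathcal H_2$ may equal the trivial subspace $\{0\}$.)
   Context: Hilbert spaces are complex and operators are bounded and linear. The tetrablock is $$\mathbb E=\{(x_1,x_2,x_3)\in\mathbb C^3 : 1-zx_1-wx_2+zwx_3\neq 0 \text{ whenever } |z|\le 1,\ |w|\le 1\},$$ and $\overline{\mathbb E}$ is its closure. A compact set $X\subset\mathbb C^n$ is a spectral set for a commuting $n$-tuple $\underline T=(T_1,\dots,T_n)$ of bounded operators on a Hilbert space if the Taylor joint spectrum $\sigma(\underline T)$ is contained in $X$ and $\|r(\underline T)\|\le\sup\{|r(z)|: z\in X\}$ for every rational function $r=p/q$ with $p,q$ holomorphic polynomials in $n$ variables and $q$ having no zeros in $X$. A triple of commuting bounded operators $(A,B,P)$ is an $\mathbb E$-contraction if $\overline{\mathbb E}$ is a spectral set for $(A,B,P)$; in this case $A,B,P$ are contractions. A commuting triple $(A,B,P)$ is an $\mathbb E$-unitary if $A,B,P$ are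 normal and the joint spectrum $\sigma(A,B,P)$ is contained in the distinguished boundary $$b\overline{\mathbb E}=\{(x_1,x_2,x_3)\in\mathbb C^3 : x_1=\overline{x_2}x_3,\ |x_2|\le 1,\ |x_3|=1\}=\{(x_1,x_2,x_3)\in\overline{\mathbb E}: |x_3|=1\}.$$ A contraction is completely non-unitary if it has no non-zero reducing subspace on which it is unitary. An $\mathbb E$-contraction $(A,B,P)$ is completely non-unitary if $P$ is a completely non-unitary contraction. For a contraction $P$ on $\mathcal H$, the maximal subspace reducing $P$ on which $P$ is unitary is $\{h\in\mathcal H:\|P^nh\|=\|h\|=\|P^{*n}h\|,\ n=1,2,\dots\}$. Operators on the trivial space $\{0\}$ are regarded as satisfying all these properties. *)

theory Defs
  imports "HOL-Analysis.Analysis" "HOL-Library.Poly_Mapping"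
begin

section \<open>Complex Hilbert spaces and operators on closed subspaces\<close>

text \<open>
  A complex Hilbert space is a complete real inner product space carrying a compatible complex
  structure. The form \<open>cinner\<close> is linear in the first argument; its real part is the real inner
  product, hence \<open>cinner x x = of_real ((norm x)\<^sup>2)\<close>, and norm and topology are the library's.
\<close>

class complex_hilbert = real_inner + complete_space +
  fixes scaleC :: "complex \<Rightarrow> 'a \<Rightarrow> 'a" (infixr "*\<^sub>C" 75)
    and cinner :: "'a \<Rightarrow> 'a \<Rightarrow> complex"
  assumes scaleC_add_right: "a *\<^sub>C (x + y) = a *\<^sub>C x + a *\<^sub>C y"
    and scaleC_add_left: "(a + b) *\<^sub>C x = a *\<^sub>C x + b *\<^sub>C x"
    and scaleC_scaleC: "a *\<^sub>C b *\<^sub>C x = (a * b) *\<^sub>C x"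
    and scaleC_of_real: "complex_of_real r *\<^sub>C x = r *\<^sub>R x"
    and cinner_add_left: "cinner (x + y) z = cinner x z + cinner y z"
    and cinner_scaleC_left: "cinner (a *\<^sub>C x) y = a * cinner x y"
    and cinner_commute: "cinner x y = cnj (cinner y x)"
    and Re_cinner: "Re (cinner x y) = x \<bullet> y"

instantiation complex :: complex_hilbert
begin

definition scaleC_complex :: "complex \<Rightarrow> complex \<Rightarrow> complex" where
  "scaleC_complex a x = a * x"

definition cinner_complex :: "complex \<Rightarrow> complex \<Rightarrow> complex" where
  "cinner_complex x y = x * cnj y"

instance
  by standard
    (simp_all add: scaleC_complex_def cinner_complex_def algebra_simps scaleR_conv_of_real
      inner_complex_def)

end

text \<open>
  A Hilbert space is represented by a closed complex subspace \<open>M\<close> of a type of class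
  \<open>complex_hilbert\<close> (the whole space being \<open>UNIV\<close>). An operator on \<open>M\<close> is represented by a function
  on the type of which only the values on \<open>M\<close> matter; so the restriction of \<open>T\<close> to a subspace \<open>N\<close>
  is \<open>T\<close> itself, considered on \<open>N\<close>. All notions below depend on \<open>T\<close> only through its values
  on \<open>M\<close>.
\<close>

definition closed_csubspace :: "'a::complex_hilbert set \<Rightarrow> bool" where
  "closed_csubspace M \<longleftrightarrow> closed M \<and> 0 \<in> M \<and> (\<forall>x\<in>M. \<forall>y\<in>M. x + y \<in> M) \<and> (\<forall>c. \<forall>x\<in>M. c *\<^sub>C x \<in> M)"

definition operator_on :: "'a::complex_hilbert set \<Rightarrow> ('a \<Rightarrow> 'a) \<Rightarrow> bool" where
  "operator_on M T \<longleftrightarrow>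
     (\<forall>x\<in>M. T x \<in> M) \<and>
     (\<forall>x\<in>M. \<forall>y\<in>M. T (x + y) = T x + T y) \<and>
     (\<forall>c. \<forall>x\<in>M. T (c *\<^sub>C x) = c *\<^sub>C T x) \<and>
     (\<exists>K. \<forall>x\<in>M. norm (T x) \<le> K * norm x)"

text \<open>The relative version of the library's \<^const>\<open>onorm\<close>.\<close>

definition onorm_on :: "'a::complex_hilbert set \<Rightarrow> ('a \<Rightarrow> 'a) \<Rightarrow> real" where
  "onorm_on M T = (SUP x\<in>M. norm (T x) / norm x)"

definition adjoint_on :: "'a::complex_hilbert set \<Rightarrow> ('a \<Rightarrow> 'a) \<Rightarrow> 'a \<Rightarrow> 'a" where
  "adjoint_on M T y = (THE z. z \<in> M \<and> (\<forall>x\<in>M. cinner (T x) y = cinner x z))"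

definition invertible_on :: "'a::complex_hilbert set \<Rightarrow> ('a \<Rightarrow> 'a) \<Rightarrow> bool" where
  "invertible_on M T \<longleftrightarrow> (\<exists>S. operator_on M S \<and> (\<forall>x\<in>M. S (T x) = x \<and> T (S x) = x))"

definition contraction_on :: "'a::complex_hilbert set \<Rightarrow> ('a \<Rightarrow> 'a) \<Rightarrow> bool" where
  "contraction_on M T \<longleftrightarrow> operator_on M T \<and> onorm_on M T \<le> 1"

definition normal_on :: "'a::complex_hilbert set \<Rightarrow> ('a \<Rightarrow> 'a) \<Rightarrow> bool" where
  "normal_on M T \<longleftrightarrow> operator_on M T \<and> (\<forall>x\<in>M. adjoint_on M T (T x) = T (adjoint_on M T x))"

definition unitary_on :: "'a::complex_hilbert set \<Rightarrow> ('a \<Rightarrow> 'a) \<Rightarrow> bool" where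
  "unitary_on M T \<longleftrightarrow>
     operator_on M T \<and> (\<forall>x\<in>M. adjoint_on M T (T x) = x \<and> T (adjoint_on M T x) = x)"

definition ortho_diff :: "'a::complex_hilbert set \<Rightarrow> 'a set \<Rightarrow> 'a set" (infixl "\<ominus>" 65) where
  "M \<ominus> N = {x\<in>M. \<forall>y\<in>N. cinner x y = 0}"

definition reduces :: "'a::complex_hilbert set \<Rightarrow> 'a set \<Rightarrow> ('a \<Rightarrow> 'a) \<Rightarrow> bool" where
  "reduces M N T \<longleftrightarrow>
     closed_csubspace N \<and> N \<subseteq> M \<and> (\<forall>x\<in>N. T x \<in> N) \<and> (\<forall>x\<in>M \<ominus> N. T x \<in> M \<ominus> N)"

definition completely_nonunitary_on :: "'a::complex_hilbert set \<Rightarrow> ('a \<Rightarrow> 'a) \<Rightarrow> bool" where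
  "completely_nonunitary_on M P \<longleftrightarrow>
     contraction_on M P \<and> (\<forall>N. reduces M N P \<and> unitary_on N P \<longrightarrow> N = {0})"

text \<open>
  The largest (with respect to inclusion) closed subspace reducing \<open>P\<close> on which \<open>P\<close> is unitary.
\<close>

definition unitary_part :: "'a::complex_hilbert set \<Rightarrow> ('a \<Rightarrow> 'a) \<Rightarrow> 'a set" where
  "unitary_part M P = (GREATEST N. reduces M N P \<and> unitary_on N P)"


section \<open>Commuting triples and the Taylor joint spectrum\<close>

definition commuting_triple_on ::
  "'a::complex_hilbert set \<Rightarrow> ('a \<Rightarrow> 'a) \<Rightarrow> ('a \<Rightarrow> 'a) \<Rightarrow> ('a \<Rightarrow> 'a) \<Rightarrow> bool" where
  "commuting_triple_on M A B P \<longleftrightarrow>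
     closed_csubspace M \<and> operator_on M A \<and> operator_on M B \<and> operator_on M P \<and>
     (\<forall>x\<in>M. A (B x) = B (A x) \<and> A (P x) = P (A x) \<and> B (P x) = P (B x))"

text \<open>
  The Koszul complex \<open>0 \<rightarrow> M \<rightarrow> M\<^sup>3 \<rightarrow> M\<^sup>3 \<rightarrow> M \<rightarrow> 0\<close> of a commuting triple: the differentials are
  \<open>\<eta> \<mapsto> (e\<^sub>1 \<otimes> A + e\<^sub>2 \<otimes> B + e\<^sub>3 \<otimes> P) \<and> \<eta>\<close> on \<open>M\<close> tensored with the exterior algebra, in the bases
  \<open>e\<^sub>1, e\<^sub>2, e\<^sub>3\<close> and \<open>e\<^sub>1\<and>e\<^sub>2, e\<^sub>1\<and>e\<^sub>3, e\<^sub>2\<and>e\<^sub>3\<close>.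
\<close>

definition koszul0 ::
  "('a \<Rightarrow> 'a) \<Rightarrow> ('a \<Rightarrow> 'a) \<Rightarrow> ('a \<Rightarrow> 'a) \<Rightarrow> 'a::complex_hilbert \<Rightarrow> 'a \<times> 'a \<times> 'a" where
  "koszul0 A B P x = (A x, B x, P x)"

definition koszul1 ::
  "('a \<Rightarrow> 'a) \<Rightarrow> ('a \<Rightarrow> 'a) \<Rightarrow> ('a \<Rightarrow> 'a) \<Rightarrow> 'a::complex_hilbert \<times> 'a \<times> 'a \<Rightarrow> 'a \<times> 'a \<times> 'a" where
  "koszul1 A B P = (\<lambda>(x, y, z). (A y - B x, A z - P x, B z - P y))"

definition koszul2 ::
  "('a \<Rightarrow> 'a) \<Rightarrow> ('a \<Rightarrow> 'a) \<Rightarrow> ('a \<Rightarrow> 'a) \<Rightarrow> 'a::complex_hilbert \<times> 'a \<times> 'a \<Rightarrow> 'a" where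
  "koszul2 A B P = (\<lambda>(u, v, w). A w - B v + P u)"

definition koszul_exact_on ::
  "'a::complex_hilbert set \<Rightarrow> ('a \<Rightarrow> 'a) \<Rightarrow> ('a \<Rightarrow> 'a) \<Rightarrow> ('a \<Rightarrow> 'a) \<Rightarrow> bool" where
  "koszul_exact_on M A B P \<longleftrightarrow>
     {x\<in>M. koszul0 A B P x = (0, 0, 0)} = {0} \<and>
     {x\<in>M \<times> M \<times> M. koszul1 A B P x = (0, 0, 0)} = koszul0 A B P ` M \<and>
     {x\<in>M \<times> M \<times> M. koszul2 A B P x = 0} = koszul1 A B P ` (M \<times> M \<times> M) \<and>
     M = koszul2 A B P ` (M \<times> M \<times> M)"

definition taylor_spectrum_on ::
  "'a::complex_hilbert set \<Rightarrow> ('a \<Rightarrow> 'a) \<Rightarrow> ('a \<Rightarrow> 'a) \<Rightarrow> ('a \<Rightarrow> 'a) \<Rightarrow> (complex \<times> complex \<times> complex) set"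
where
  "taylor_spectrum_on M A B P =
     {(a, b, c). \<not> koszul_exact_on M (\<lambda>x. A x - a *\<^sub>C x) (\<lambda>x. B x - b *\<^sub>C x) (\<lambda>x. P x - c *\<^sub>C x)}"


section \<open>Polynomials in three variables and spectral sets\<close>

text \<open>A polynomial is a finitely supported family of coefficients indexed by exponents.\<close>

type_synonym poly3 = "nat \<times> nat \<times> nat \<Rightarrow>\<^sub>0 complex"

definition eval3 :: "poly3 \<Rightarrow> complex \<times> complex \<times> complex \<Rightarrow> complex" where
  "eval3 p = (\<lambda>(x, y, z). \<Sum>(i, j, k)\<in>Poly_Mapping.keys p. Poly_Mapping.lookup p (i, j, k) * (x ^ i * y ^ j * z ^ k))"

definition eval3_op ::
  "poly3 \<Rightarrow> ('a \<Rightarrow> 'a) \<Rightarrow> ('a \<Rightarrow> 'a) \<Rightarrow> ('a \<Rightarrow> 'a) \<Rightarrow> 'a::complex_hilbert \<Rightarrow> 'a" where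
  "eval3_op p A B P h =
     (\<Sum>(i, j, k)\<in>Poly_Mapping.keys p. Poly_Mapping.lookup p (i, j, k) *\<^sub>C (A ^^ i) ((B ^^ j) ((P ^^ k) h)))"

text \<open>
  For \<open>r = p/q\<close> the operator \<open>r(A,B,P)\<close> is \<open>p(A,B,P) q(A,B,P)\<^sup>-\<^sup>1\<close>. The clause that \<open>q(A,B,P)\<close> be
  invertible says that this operator is defined; by the spectral mapping theorem it is implied by the
  inclusion of the joint spectrum in \<open>X\<close>.
\<close>

definition spectral_set_on ::
  "(complex \<times> complex \<times> complex) set \<Rightarrow>
     'a::complex_hilbert set \<Rightarrow> ('a \<Rightarrow> 'a) \<Rightarrow> ('a \<Rightarrow> 'a) \<Rightarrow> ('a \<Rightarrow> 'a) \<Rightarrow> bool" where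
  "spectral_set_on X M A B P \<longleftrightarrow>
     compact X \<and> commuting_triple_on M A B P \<and> taylor_spectrum_on M A B P \<subseteq> X \<and>
     (\<forall>p q. (\<forall>x\<in>X. eval3 q x \<noteq> 0) \<longrightarrow>
        invertible_on M (eval3_op q A B P) \<and>
        onorm_on M (\<lambda>h. eval3_op p A B P (inv_into M (eval3_op q A B P) h))
          \<le> (SUP x\<in>X. norm (eval3 p x / eval3 q x)))"


section \<open>The tetrablock\<close>

definition tetrablock :: "(complex \<times> complex \<times> complex) set" where
  "tetrablock = {(x1, x2, x3). \<forall>z w. norm z \<le> 1 \<and> norm w \<le> 1 \<longrightarrow> 1 - z * x1 - w * x2 + z * w * x3 \<noteq> 0}"

definition distinguished_boundary :: "(complex \<times> complex \<times> complex) set" where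
  "distinguished_boundary = {(x1, x2, x3). x1 = cnj x2 * x3 \<and> norm x2 \<le> 1 \<and> norm x3 = 1}"

definition tetrablock_contraction_on ::
  "'a::complex_hilbert set \<Rightarrow> ('a \<Rightarrow> 'a) \<Rightarrow> ('a \<Rightarrow> 'a) \<Rightarrow> ('a \<Rightarrow> 'a) \<Rightarrow> bool" where
  "tetrablock_contraction_on M A B P \<longleftrightarrow> spectral_set_on (closure tetrablock) M A B P"

definition tetrablock_unitary_on ::
  "'a::complex_hilbert set \<Rightarrow> ('a \<Rightarrow> 'a) \<Rightarrow> ('a \<Rightarrow> 'a) \<Rightarrow> ('a \<Rightarrow> 'a) \<Rightarrow> bool" where
  "tetrablock_unitary_on M A B P \<longleftrightarrow>
     commuting_triple_on M A B P \<and> normal_on M A \<and> normal_on M B \<and> normal_on M P \<and>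
     taylor_spectrum_on M A B P \<subseteq> distinguished_boundary"

definition cnu_tetrablock_contraction_on ::
  "'a::complex_hilbert set \<Rightarrow> ('a \<Rightarrow> 'a) \<Rightarrow> ('a \<Rightarrow> 'a) \<Rightarrow> ('a \<Rightarrow> 'a) \<Rightarrow> bool" where
  "cnu_tetrablock_contraction_on M A B P \<longleftrightarrow>
     tetrablock_contraction_on M A B P \<and> completely_nonunitary_on M P"

end

theory Submission
  imports Defs
begin

text \<open>
  Why the theorem is true. For \<open>\<bar>z\<bar> < 1\<close> the rational functions \<open>(x\<^sub>1 - z x\<^sub>3) / (1 - z x\<^sub>2)\<close> and
  \<open>(x\<^sub>2 - z x\<^sub>3) / (1 - z x\<^sub>1)\<close> are bounded by one on the closed tetrablock. The spectral set
  inequality turns this into \<open>\<parallel>(A - z P) h\<parallel> \<le> \<parallel>(1 - z B) h\<parallel>\<close> and its mirror image, for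
  \<open>\<bar>z\<bar> = 1\<close> by a limit. Squaring and adding eliminates \<open>\<parallel>A h\<parallel>\<close> and \<open>\<parallel>B h\<parallel>\<close> and leaves
  \<open>Re (v (\<langle>h, B h\<rangle> - \<langle>A h, P h\<rangle>)) \<le> \<parallel>h\<parallel>\<^sup>2 - \<parallel>P h\<parallel>\<^sup>2\<close> for all unimodular \<open>v\<close>
  (\<open>tetrablock_contraction_form_le\<close>). In particular \<open>P\<close> is a contraction.

  The right-hand side vanishes at vectors \<open>u\<close> with \<open>P\<^sup>*P u = u\<close>, and a positive form has no cross
  terms with its null vectors. So at such vectors \<open>B u = A\<^sup>* P u\<close>, \<open>B\<^sup>* u = P\<^sup>* A u\<close>, and the same with
  \<open>A\<close> and \<open>B\<close> exchanged (\<open>tetrablock_contraction_adjoints\<close>). On the unitary part of \<open>P\<close>, which is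
  \<open>{h. \<parallel>P\<^sup>n h\<parallel> = \<parallel>h\<parallel> = \<parallel>P\<^sup>*\<^sup>n h\<parallel> for all n}\<close>, these four identities and commutativity imply
  everything algebraic: \<open>A\<close>, \<open>B\<close> and their adjoints leave the subspace invariant, and there
  \<open>A\<close>, \<open>B\<close>, \<open>P\<close> commute with all three adjoints.

  For the joint spectrum, a commuting triple of normal operators that is jointly bounded below has
  an exact Koszul complex (\<open>koszul_exact_on_normal\<close>): \<open>G = \<Sum> T\<^sub>i\<^sup>* T\<^sub>i\<close> is invertible, and
  \<open>G\<^sup>-\<^sup>1 T\<^sub>i\<^sup>*\<close> defines a contracting homotopy. The relation \<open>A = B\<^sup>* P\<close> and the isometry of \<open>P\<close>
  bound \<open>(A - a, B - b, P - c)\<close> below unless \<open>\<bar>c\<bar> = 1\<close> and \<open>a = cnj b * c\<close>.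

  The restriction of a spectral set to a reducing subspace costs nothing, because the orthogonal
  projection commutes with all operators in sight; this settles the complement, where maximality of
  the unitary part makes \<open>P\<close> completely non-unitary.
\<close>

section \<open>Complex inner products and orthogonal projections\<close>

lemma cinner_add_right: "cinner x (y + z) = cinner x y + cinner x z"
  by (metis cinner_commute cinner_add_left complex_cnj_add)

lemma cinner_scaleC_right: "cinner x (c *\<^sub>C y) = cnj c * cinner x y"
  by (metis cinner_commute cinner_scaleC_left complex_cnj_mult)

lemma scaleC_zero_left [simp]: "0 *\<^sub>C (x::'a::complex_hilbert) = 0"
  using scaleC_of_real[of 0 x] by simp

lemma scaleC_one [simp]: "1 *\<^sub>C (x::'a::complex_hilbert) = x"
  using scaleC_of_real[of 1 x] by simp

lemma scaleC_minus_one: "(-1) *\<^sub>C (x::'a::complex_hilbert) = - x"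
  using scaleC_of_real[of "-1" x] by simp

lemma scaleC_zero_right [simp]: "c *\<^sub>C (0::'a::complex_hilbert) = 0"
  by (metis add_cancel_right_left scaleC_add_right)

lemma scaleC_minus_right: "c *\<^sub>C (- x) = - (c *\<^sub>C (x::'a::complex_hilbert))"
  by (metis scaleC_minus_one scaleC_scaleC mult.commute)

lemma scaleC_minus_left: "(- c) *\<^sub>C x = - (c *\<^sub>C (x::'a::complex_hilbert))"
  by (metis scaleC_minus_one scaleC_scaleC mult_minus1)

lemma scaleC_diff_right: "c *\<^sub>C (x - y) = c *\<^sub>C x - c *\<^sub>C (y::'a::complex_hilbert)"
  by (metis scaleC_minus_right scaleC_add_right diff_conv_add_uminus)

lemma scaleC_diff_left: "(c - d) *\<^sub>C x = c *\<^sub>C x - d *\<^sub>C (x::'a::complex_hilbert)"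
  by (metis scaleC_minus_left scaleC_add_left diff_conv_add_uminus)

lemma cinner_zero_left [simp]: "cinner 0 y = 0"
  by (metis cinner_scaleC_left mult_zero_left scaleC_zero_left)

lemma cinner_zero_right [simp]: "cinner x 0 = 0"
  by (metis cinner_commute cinner_zero_left complex_cnj_zero)

lemma cinner_minus_left: "cinner (- x) y = - cinner x y"
  by (metis cinner_scaleC_left scaleC_minus_one mult_minus1)

lemma cinner_minus_right: "cinner x (- y) = - cinner x y"
  by (metis cinner_commute cinner_minus_left complex_cnj_minus)

lemma cinner_diff_left: "cinner (x - y) z = cinner x z - cinner y z"
  by (metis cinner_add_left cinner_minus_left diff_conv_add_uminus)

lemma cinner_diff_right: "cinner x (y - z) = cinner x y - cinner x z"
  by (metis cinner_add_right cinner_minus_right diff_conv_add_uminus)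

lemma cinner_self: "cinner x x = of_real ((norm x)\<^sup>2)"
proof -
  have "Im (cinner x x) = 0"
    using arg_cong[OF cinner_commute[of x x], of Im] by simp
  then show ?thesis
    by (simp add: complex_eq_iff Re_cinner power2_norm_eq_inner)
qed

lemma norm_scaleC [simp]: "norm (c *\<^sub>C (x::'a::complex_hilbert)) = cmod c * norm x"
proof -
  have "complex_of_real ((norm (c *\<^sub>C x))\<^sup>2) = complex_of_real ((cmod c * norm x)\<^sup>2)"
    unfolding cinner_self[symmetric] cinner_scaleC_left cinner_scaleC_right
    using complex_norm_square[of c] by (simp add: cinner_self power_mult_distrib mult.commute)
  then have "(norm (c *\<^sub>C x))\<^sup>2 = (cmod c * norm x)\<^sup>2"
    using of_real_eq_iff by blast
  then show ?thesis
    by (simp add: power2_eq_iff_nonneg)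
qed

lemma cmod_cinner_le: "cmod (cinner x y) \<le> norm x * norm y"
proof (cases "cinner x y = 0")
  case False
  let ?c = "cnj (cinner x y) / cmod (cinner x y)"
  have "cmod (cinner x y) = Re (cinner (?c *\<^sub>C x) y)"
  proof -
    have "cinner (?c *\<^sub>C x) y = of_real ((cmod (cinner x y))\<^sup>2) / of_real (cmod (cinner x y))"
      using complex_norm_square[of "cinner x y"] by (simp add: cinner_scaleC_left mult.commute)
    then show ?thesis
      using False by (simp add: power2_eq_square)
  qed
  also have "\<dots> \<le> norm (?c *\<^sub>C x) * norm y"
    unfolding Re_cinner by (rule norm_cauchy_schwarz)
  also have "\<dots> = norm x * norm y"
    using False by (simp add: norm_divide)
  finally show ?thesis .
qed simp

text \<open>Rotating the second argument by \<open>\<i>\<close> exchanges real and imaginary part of the form, and the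
  real part is the real inner product.\<close>

lemma cinner_eq_0_if_real:
  assumes "x \<bullet> y = 0" "x \<bullet> (\<i> *\<^sub>C y) = 0"
  shows "cinner x y = 0"
proof -
  have "Re (cinner x (\<i> *\<^sub>C y)) = Im (cinner x y)"
    by (simp add: cinner_scaleC_right)
  then show ?thesis
    using assms by (simp add: complex_eq_iff Re_cinner)
qed

lemma cinner_eqI:
  assumes "\<And>z. cinner z x = cinner z y"
  shows "x = y"
proof -
  have "cinner (x - y) (x - y) = 0"
    using assms[of "x - y"] by (simp add: cinner_diff_right)
  then show ?thesis
    by (simp add: cinner_self)
qed

lemma norm_diff_square:
  "(norm (x - y))\<^sup>2 = (norm x)\<^sup>2 + (norm y)\<^sup>2 - 2 * Re (cinner x (y::'a::complex_hilbert))"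
  by (simp add: Re_cinner power2_norm_eq_inner inner_diff_left inner_diff_right inner_commute)

lemma closed_csubspaceD:
  assumes "closed_csubspace M"
  shows "closed M" "0 \<in> M" "\<And>x y. x \<in> M \<Longrightarrow> y \<in> M \<Longrightarrow> x + y \<in> M"
    "\<And>c x. x \<in> M \<Longrightarrow> c *\<^sub>C x \<in> M" "\<And>x y. x \<in> M \<Longrightarrow> y \<in> M \<Longrightarrow> x - y \<in> M"
    "\<And>x. x \<in> M \<Longrightarrow> - x \<in> M" "\<And>r x. x \<in> M \<Longrightarrow> r *\<^sub>R x \<in> M"
proof -
  show *: "closed M" "0 \<in> M" "\<And>x y. x \<in> M \<Longrightarrow> y \<in> M \<Longrightarrow> x + y \<in> M"
    "\<And>c x. x \<in> M \<Longrightarrow> c *\<^sub>C x \<in> M"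
    using assms unfolding closed_csubspace_def by auto
  show neg: "- x \<in> M" if "x \<in> M" for x
    using *(4)[OF that, of "-1"] by (simp add: scaleC_minus_one)
  show "x - y \<in> M" if "x \<in> M" "y \<in> M" for x y
    using *(3)[OF that(1) neg[OF that(2)]] by simp
  show "r *\<^sub>R x \<in> M" if "x \<in> M" for r x
    using *(4)[OF that, of "of_real r"] by (simp add: scaleC_of_real)
qed

text \<open>A minimising sequence is Cauchy by the parallelogram law: the midpoint of two almost closest
  points is again in the subspace, so it cannot be much closer to \<open>x\<close> than they are.\<close>

lemma closest_point_exists:
  assumes M: "closed_csubspace M"
  shows "\<exists>y\<in>M. \<forall>z\<in>M. dist x y \<le> dist x z"
proof -
  note MD = closed_csubspaceD[OF M]
  define d where "d = infdist x M"
  have ne: "M \<noteq> {}" using MD(2) by auto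
  have d0: "d \<ge> 0" by (simp add: d_def infdist_nonneg)
  define S where "S n = {y\<in>M. dist x y \<le> d + inverse (real (Suc n))}" for n
  have close: "(dist y z)\<^sup>2 \<le> 4 * ((d + e)\<^sup>2 - d\<^sup>2)"
    if "y \<in> M" "z \<in> M" "dist x y \<le> d + e" "dist x z \<le> d + e" for y z e
  proof -
    let ?m = "(1/2) *\<^sub>R (y + z)"
    have "?m \<in> M" using MD(3,7) that by blast
    then have "d \<le> dist x ?m" unfolding d_def by (rule infdist_le)
    then have m: "d\<^sup>2 \<le> (norm (x - ?m))\<^sup>2"
      using d0 by (simp add: dist_norm power_mono)
    have "(norm (x - y))\<^sup>2 \<le> (d + e)\<^sup>2" "(norm (x - z))\<^sup>2 \<le> (d + e)\<^sup>2"
      using that by (auto simp: dist_norm intro!: power_mono)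
    moreover have "(norm (y - z))\<^sup>2
        = 2 * (norm (x - y))\<^sup>2 + 2 * (norm (x - z))\<^sup>2 - 4 * (norm (x - ?m))\<^sup>2"
      by (simp add: power2_norm_eq_inner inner_diff_left inner_diff_right inner_add_left
          inner_add_right inner_commute algebra_simps)
    ultimately show ?thesis using m by (simp add: dist_norm)
  qed
  obtain a where a: "\<And>n. a \<in> S n"
  proof (rule decreasing_closed_nest[of S])
    show "closed (S n)" for n
    proof -
      have "S n = M \<inter> cball x (d + inverse (real (Suc n)))" by (auto simp: S_def)
      then show ?thesis using MD(1) by auto
    qed
    show "S n \<noteq> {}" for n
    proof -
      have "infdist x M < d + inverse (real (Suc n))" by (simp add: d_def)
      then obtain y where "y \<in> M" "dist x y < d + inverse (real (Suc n))"
        unfolding infdist_notempty[OF ne] using ne by (auto simp: cINF_less_iff)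
      then show ?thesis by (force simp: S_def)
    qed
    show "S n \<subseteq> S m" if "m \<le> n" for m n
    proof -
      have "inverse (real (Suc n)) \<le> inverse (real (Suc m))"
        using that by (intro le_imp_inverse_le) auto
      then show ?thesis unfolding S_def by (intro subsetI) (clarify, linarith)
    qed
    show "\<exists>n. \<forall>y\<in>S n. \<forall>z\<in>S n. dist y z < e" if "e > 0" for e
    proof -
      have "(\<lambda>n. 4 * ((d + inverse (real (Suc n)))\<^sup>2 - d\<^sup>2)) \<longlonglongrightarrow> 4 * ((d + 0)\<^sup>2 - d\<^sup>2)"
        by (intro tendsto_intros LIMSEQ_inverse_real_of_nat)
      then have "\<forall>\<^sub>F n in sequentially. 4 * ((d + inverse (real (Suc n)))\<^sup>2 - d\<^sup>2) < e\<^sup>2"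
        using that by (intro order_tendstoD(2)) auto
      then obtain n where n: "4 * ((d + inverse (real (Suc n)))\<^sup>2 - d\<^sup>2) < e\<^sup>2"
        using eventually_happens'[OF sequentially_bot] by blast
      have "dist y z < e" if "y \<in> S n" "z \<in> S n" for y z
      proof -
        have "(dist y z)\<^sup>2 < e\<^sup>2"
          using close[of y z "inverse (real (Suc n))"] that n unfolding S_def by auto
        then show ?thesis
          using \<open>e > 0\<close> power2_less_imp_less by (metis less_imp_le)
      qed
      then show ?thesis by blast
    qed
  qed blast
  have "dist x a \<le> d"
  proof (rule LIMSEQ_le_const)
    show "(\<lambda>n. d + inverse (real (Suc n))) \<longlonglongrightarrow> d"
      using tendsto_add[OF tendsto_const LIMSEQ_inverse_real_of_nat, of d] by simp
    show "\<exists>N. \<forall>n\<ge>N. dist x a \<le> d + inverse (real (Suc n))"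
      using a by (auto simp: S_def)
  qed
  moreover have "a \<in> M" using a[of 0] by (simp add: S_def)
  ultimately show ?thesis
    unfolding d_def by (meson infdist_le order_trans)
qed

lemma ortho_diff_decompose:
  assumes M: "closed_csubspace M"
  shows "\<exists>y\<in>M. x - y \<in> UNIV \<ominus> M"
proof -
  note MD = closed_csubspaceD[OF M]
  obtain y where y: "y \<in> M" "\<forall>z\<in>M. dist x y \<le> dist x z"
    using closest_point_exists[OF M] by blast
  have conv: "convex M"
    using MD(3,7) by (auto simp: convex_def)
  have real0: "(x - y) \<bullet> z = 0" if "z \<in> M" for z
  proof -
    have "(x - y) \<bullet> ((y + z) - y) \<le> 0" "(x - y) \<bullet> ((y - z) - y) \<le> 0"
      by (intro any_closest_point_dot[OF conv MD(1)] y MD(3,5) that)+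
    then show ?thesis by simp
  qed
  then have "cinner (x - y) z = 0" if "z \<in> M" for z
    using MD(4)[OF that] that by (auto intro: cinner_eq_0_if_real)
  then show ?thesis
    using y(1) by (auto simp: ortho_diff_def)
qed

lemma closed_csubspace_UNIV: "closed_csubspace UNIV"
  by (simp add: closed_csubspace_def)

lemma ortho_diff_self: "x \<in> M \<Longrightarrow> x \<in> UNIV \<ominus> M \<Longrightarrow> x = 0"
  by (auto simp: ortho_diff_def cinner_self)

definition orth_proj :: "'a::complex_hilbert set \<Rightarrow> 'a \<Rightarrow> 'a" where
  "orth_proj M x = (SOME y. y \<in> M \<and> x - y \<in> UNIV \<ominus> M)"

lemma continuous_cinner_left: "continuous_on UNIV (\<lambda>x. cinner x (y::'a::complex_hilbert))"
proof -
  have "bounded_linear (\<lambda>x. cinner x y)"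
  proof (rule bounded_linear_intro)
    show "cinner (x + z) y = cinner x y + cinner z y" for x z by (rule cinner_add_left)
    show "cinner (r *\<^sub>R x) y = r *\<^sub>R cinner x y" for r x
      by (metis cinner_scaleC_left scaleC_of_real scaleR_conv_of_real)
    show "norm (cinner x y) \<le> norm x * norm y" for x by (rule cmod_cinner_le)
  qed
  then show ?thesis by (rule linear_continuous_on)
qed

lemma closed_csubspace_ortho:
  "closed_csubspace (UNIV \<ominus> M)"
proof -
  have "UNIV \<ominus> M = (\<Inter>y\<in>M. {x. cinner x y = 0})"
    by (auto simp: ortho_diff_def)
  moreover have "closed {x. cinner x y = 0}" for y :: 'a
    by (intro closed_Collect_eq continuous_cinner_left continuous_on_const)
  ultimately have "closed (UNIV \<ominus> M)" by auto
  then show ?thesis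
    by (auto simp: closed_csubspace_def ortho_diff_def cinner_add_left cinner_scaleC_left)
qed

lemma orth_proj:
  assumes "closed_csubspace M"
  shows "orth_proj M x \<in> M" "x - orth_proj M x \<in> UNIV \<ominus> M"
  using someI_ex[of "\<lambda>y. y \<in> M \<and> x - y \<in> UNIV \<ominus> M"] ortho_diff_decompose[OF assms, of x]
  unfolding orth_proj_def by auto

lemma orth_proj_eqI:
  assumes M: "closed_csubspace M" and "y \<in> M" "x - y \<in> UNIV \<ominus> M"
  shows "orth_proj M x = y"
proof -
  let ?p = "orth_proj M x"
  have "?p - y \<in> M"
    by (intro closed_csubspaceD(5)[OF M] orth_proj(1)[OF M] assms)
  moreover have "(x - y) - (x - ?p) \<in> UNIV \<ominus> M"
    by (intro closed_csubspaceD(5)[OF closed_csubspace_ortho] orth_proj(2)[OF M] assms)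
  ultimately have "?p - y = 0"
    by (intro ortho_diff_self) auto
  then show ?thesis by simp
qed

lemma orth_proj_in: "closed_csubspace M \<Longrightarrow> x \<in> M \<Longrightarrow> orth_proj M x = x"
  by (rule orth_proj_eqI) (auto simp: ortho_diff_def)

lemma orth_proj_add:
  assumes M: "closed_csubspace M"
  shows "orth_proj M (x + y) = orth_proj M x + orth_proj M y"
proof (rule orth_proj_eqI[OF M])
  show "orth_proj M x + orth_proj M y \<in> M"
    by (intro closed_csubspaceD(3)[OF M] orth_proj(1)[OF M])
  have "(x - orth_proj M x) + (y - orth_proj M y) \<in> UNIV \<ominus> M"
    by (intro closed_csubspaceD(3)[OF closed_csubspace_ortho] orth_proj(2)[OF M])
  then show "x + y - (orth_proj M x + orth_proj M y) \<in> UNIV \<ominus> M"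
    by (simp add: algebra_simps)
qed

lemma orth_proj_diff:
  assumes M: "closed_csubspace M"
  shows "orth_proj M (x - y) = orth_proj M x - orth_proj M y"
  using orth_proj_add[OF M, of "x - y" y] by simp

lemma ortho_ortho:
  assumes M: "closed_csubspace M"
  shows "UNIV \<ominus> (UNIV \<ominus> M) = M"
proof
  show "M \<subseteq> UNIV \<ominus> (UNIV \<ominus> M)"
    by (auto simp: ortho_diff_def) (metis cinner_commute complex_cnj_zero)
  show "UNIV \<ominus> (UNIV \<ominus> M) \<subseteq> M"
  proof
    fix x assume x: "x \<in> UNIV \<ominus> (UNIV \<ominus> M)"
    let ?p = "orth_proj M x"
    have "?p \<in> UNIV \<ominus> (UNIV \<ominus> M)"
      using \<open>M \<subseteq> UNIV \<ominus> (UNIV \<ominus> M)\<close> orth_proj(1)[OF M, of x] by (rule subsetD)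
    then have "x - ?p \<in> UNIV \<ominus> (UNIV \<ominus> M)"
      by (rule closed_csubspaceD(5)[OF closed_csubspace_ortho x])
    then have "x - ?p = 0"
      by (rule ortho_diff_self[OF orth_proj(2)[OF M]])
    then show "x \<in> M" using orth_proj(1)[OF M, of x] by simp
  qed
qed

section \<open>Operators and adjoints\<close>

lemma operator_onD:
  assumes "operator_on M T"
  shows "\<And>x. x \<in> M \<Longrightarrow> T x \<in> M" "\<And>x y. x \<in> M \<Longrightarrow> y \<in> M \<Longrightarrow> T (x + y) = T x + T y"
    "\<And>c x. x \<in> M \<Longrightarrow> T (c *\<^sub>C x) = c *\<^sub>C T x"
  using assms unfolding operator_on_def by auto

lemma operator_on_bound:
  assumes "operator_on M T"
  obtains K where "K > 0" "\<And>x. x \<in> M \<Longrightarrow> norm (T x) \<le> K * norm x"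
proof -
  obtain K where K: "\<forall>x\<in>M. norm (T x) \<le> K * norm x"
    using assms unfolding operator_on_def by auto
  have "norm (T x) \<le> max K 1 * norm x" if "x \<in> M" for x
    using K that by (meson max.cobounded1 mult_right_mono norm_ge_zero order_trans)
  then show ?thesis using that[of "max K 1"] by auto
qed

lemma operator_onI:
  assumes "\<And>x. x \<in> M \<Longrightarrow> T x \<in> M" "\<And>x y. x \<in> M \<Longrightarrow> y \<in> M \<Longrightarrow> T (x + y) = T x + T y"
    "\<And>c x. x \<in> M \<Longrightarrow> T (c *\<^sub>C x) = c *\<^sub>C T x" "\<And>x. x \<in> M \<Longrightarrow> norm (T x) \<le> K * norm x"
  shows "operator_on M T"
  using assms unfolding operator_on_def by blast

lemma operator_on_diff:
  assumes "operator_on M T" "closed_csubspace M" "x \<in> M" "y \<in> M"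
  shows "T (x - y) = T x - T y"
  using operator_onD(2)[OF assms(1) closed_csubspaceD(5)[OF assms(2,3,4)] assms(4)] by simp

lemma operator_on_zero:
  assumes "operator_on M T" "closed_csubspace M"
  shows "T 0 = 0"
  using operator_on_diff[OF assms closed_csubspaceD(2)[OF assms(2)] closed_csubspaceD(2)[OF assms(2)]] by simp

lemma operator_on_subset:
  assumes "operator_on M T" "N \<subseteq> M" "\<And>x. x \<in> N \<Longrightarrow> T x \<in> N"
  shows "operator_on N T"
  using assms unfolding operator_on_def by (meson subset_iff)

lemma operator_on_compose:
  assumes "operator_on M S" "operator_on M T"
  shows "operator_on M (\<lambda>x. S (T x))"
proof -
  obtain K where K: "K > 0" "\<And>x. x \<in> M \<Longrightarrow> norm (S x) \<le> K * norm x"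
    using operator_on_bound[OF assms(1)] by blast
  obtain L where L: "L > 0" "\<And>x. x \<in> M \<Longrightarrow> norm (T x) \<le> L * norm x"
    using operator_on_bound[OF assms(2)] by blast
  show ?thesis
  proof (rule operator_onI)
    show "norm (S (T x)) \<le> (K * L) * norm x" if "x \<in> M" for x
    proof -
      have "norm (S (T x)) \<le> K * norm (T x)"
        using K operator_onD[OF assms(2)] that by blast
      also have "\<dots> \<le> K * (L * norm x)"
        using K L that by (intro mult_left_mono) auto
      finally show ?thesis by (simp add: mult.assoc)
    qed
  qed (simp_all add: operator_onD[OF assms(1)] operator_onD[OF assms(2)])
qed

lemma operator_on_add:
  assumes "closed_csubspace M" "operator_on M S" "operator_on M T"
  shows "operator_on M (\<lambda>x. S x + T x)"
proof -
  obtain K where K: "K > 0" "\<And>x. x \<in> M \<Longrightarrow> norm (S x) \<le> K * norm x"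
    using operator_on_bound[OF assms(2)] by blast
  obtain L where L: "L > 0" "\<And>x. x \<in> M \<Longrightarrow> norm (T x) \<le> L * norm x"
    using operator_on_bound[OF assms(3)] by blast
  show ?thesis
  proof (rule operator_onI)
    show "norm (S x + T x) \<le> (K + L) * norm x" if "x \<in> M" for x
      using norm_triangle_ineq[of "S x" "T x"] K(2)[OF that] L(2)[OF that]
      by (simp add: algebra_simps)
    show "S x + T x \<in> M" if "x \<in> M" for x
      by (intro closed_csubspaceD(3)[OF assms(1)] operator_onD(1)[OF assms(2) that]
          operator_onD(1)[OF assms(3) that])
  qed (simp_all add: operator_onD[OF assms(2)] operator_onD[OF assms(3)] scaleC_add_right)
qed

lemma operator_on_scale:
  assumes "closed_csubspace M" "operator_on M T"
  shows "operator_on M (\<lambda>x. c *\<^sub>C T x)"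
proof -
  obtain L where L: "L > 0" "\<And>x. x \<in> M \<Longrightarrow> norm (T x) \<le> L * norm x"
    using operator_on_bound[OF assms(2)] by blast
  show ?thesis
  proof (rule operator_onI)
    show "norm (c *\<^sub>C T x) \<le> (cmod c * L) * norm x" if "x \<in> M" for x
      using mult_left_mono[OF L(2)[OF that], of "cmod c"] by simp
    show "c *\<^sub>C T x \<in> M" if "x \<in> M" for x
      by (intro closed_csubspaceD(4)[OF assms(1)] operator_onD(1)[OF assms(2) that])
  qed (simp_all add: operator_onD[OF assms(2)] scaleC_add_right scaleC_scaleC mult.commute)
qed

lemma operator_on_id: "operator_on M (\<lambda>x. x)"
  by (rule operator_onI[where K = 1]) auto

lemma operator_on_shift:
  assumes "closed_csubspace M" "operator_on M T"
  shows "operator_on M (\<lambda>x. T x - c *\<^sub>C x)"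
  using operator_on_add[OF assms operator_on_scale[OF assms(1) operator_on_id, of "- c"]]
  by (simp add: scaleC_minus_left)

lemma bounded_linear_operator:
  assumes "operator_on UNIV T"
  shows "bounded_linear T"
proof -
  obtain K where K: "K > 0" "\<And>x. norm (T x) \<le> K * norm x"
    using operator_on_bound[OF assms] by auto
  show ?thesis
  proof (rule bounded_linear_intro[where K = K])
    show "T (x + y) = T x + T y" for x y using operator_onD(2)[OF assms] by simp
    show "T (r *\<^sub>R x) = r *\<^sub>R T x" for r x
      using operator_onD(3)[OF assms, of x "of_real r"] by (simp add: scaleC_of_real)
    show "norm (T x) \<le> norm x * K" for x using K(2)[of x] by (simp add: mult.commute)
  qed
qed

text \<open>The representing vector is found on the line orthogonal to the kernel of \<open>f\<close>.\<close>

lemma bounded_functional_representation: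
  fixes f :: "'a::complex_hilbert \<Rightarrow> complex"
  assumes add: "\<And>x y. f (x + y) = f x + f y" and scale: "\<And>c x. f (c *\<^sub>C x) = c * f x"
    and bound: "\<And>x. cmod (f x) \<le> K * norm x"
  shows "\<exists>y. \<forall>x. f x = cinner x y"
proof (cases "\<forall>x. f x = 0")
  case True
  then show ?thesis by (intro exI[of _ 0]) simp
next
  case False
  then obtain x0 where x0: "f x0 \<noteq> 0" by blast
  define M where "M = {x. f x = 0}"
  have diff: "f (x - y) = f x - f y" for x y
    using add[of "x - y" y] by simp
  have "bounded_linear f"
  proof (rule bounded_linear_intro[where K = K])
    show "f (r *\<^sub>R x) = r *\<^sub>R f x" for r x
      by (metis scale scaleC_of_real scaleR_conv_of_real)
  qed (use add bound in \<open>auto simp: mult.commute\<close>)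
  then have "closed M"
    unfolding M_def by (intro closed_Collect_eq linear_continuous_on continuous_on_const)
  then have M: "closed_csubspace M"
    using scale[of 0 0] by (auto simp: closed_csubspace_def M_def add scale)
  define v where "v = x0 - orth_proj M x0"
  have v: "v \<in> UNIV \<ominus> M" and fv: "f v \<noteq> 0"
    using orth_proj[OF M, of x0] x0 by (auto simp: v_def diff M_def)
  have "f 0 = 0" using scale[of 0 0] by simp
  then have v0: "v \<noteq> 0" using fv by auto
  have "f x = cinner x ((cnj (f v) / (norm v)\<^sup>2) *\<^sub>C v)" for x
  proof -
    have "x - (f x / f v) *\<^sub>C v \<in> M"
      using fv by (simp add: M_def diff scale)
    then have "cinner v (x - (f x / f v) *\<^sub>C v) = 0"
      using v by (auto simp: ortho_diff_def)
    then have "cinner (x - (f x / f v) *\<^sub>C v) v = 0"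
      by (metis cinner_commute complex_cnj_zero)
    then have "cinner x v = (f x / f v) * (norm v)\<^sup>2"
      by (simp add: cinner_diff_left cinner_scaleC_left cinner_self)
    then show ?thesis
      using fv v0 by (simp add: cinner_scaleC_right)
  qed
  then show ?thesis by blast
qed

lemma adjoint_on_eqI:
  assumes M: "closed_csubspace M" and z: "z \<in> M" "\<And>x. x \<in> M \<Longrightarrow> cinner (T x) y = cinner x z"
  shows "adjoint_on M T y = z"
  unfolding adjoint_on_def
proof (rule the_equality)
  fix w assume w: "w \<in> M \<and> (\<forall>x\<in>M. cinner (T x) y = cinner x w)"
  then have "w - z \<in> M" using z closed_csubspaceD(5)[OF M] by blast
  then have "cinner (w - z) (w - z) = 0"
    using w z(2)[of "w - z"] by (simp add: cinner_diff_right)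
  then show "w = z" by (simp add: cinner_self)
qed (use z in blast)

lemma cinner_adjoint:
  assumes T: "operator_on UNIV T"
  shows "cinner (T x) y = cinner x (adjoint_on UNIV T y)"
proof -
  obtain K where K: "K > 0" "\<And>x. norm (T x) \<le> K * norm x"
    using operator_on_bound[OF T] by auto
  have "\<exists>z. \<forall>x. cinner (T x) y = cinner x z"
  proof (rule bounded_functional_representation)
    show "cmod (cinner (T x) y) \<le> (K * norm y) * norm x" for x
    proof -
      have "cmod (cinner (T x) y) \<le> norm (T x) * norm y" by (rule cmod_cinner_le)
      also have "\<dots> \<le> (K * norm x) * norm y" by (intro mult_right_mono K(2)) simp
      finally show ?thesis by (simp add: mult_ac)
    qed
  qed (simp_all add: operator_onD(2,3)[OF T] cinner_add_left cinner_scaleC_left)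
  then obtain z where z: "\<forall>x. cinner (T x) y = cinner x z" by blast
  then have "adjoint_on UNIV T y = z"
    by (intro adjoint_on_eqI closed_csubspace_UNIV) auto
  then show ?thesis using z by simp
qed

lemma cinner_adjoint':
  assumes T: "operator_on UNIV T"
  shows "cinner y (T x) = cinner (adjoint_on UNIV T y) x"
  by (metis cinner_adjoint[OF T] cinner_commute)

lemma operator_on_adjoint:
  assumes T: "operator_on UNIV T"
  shows "operator_on UNIV (adjoint_on UNIV T)"
proof -
  let ?T = "adjoint_on UNIV T"
  obtain K where K: "K > 0" "\<And>x. norm (T x) \<le> K * norm x"
    using operator_on_bound[OF T] by auto
  show ?thesis
  proof (rule operator_onI[where K = K])
    show "?T (x + y) = ?T x + ?T y" for x y
      by (rule cinner_eqI) (simp add: cinner_add_right cinner_adjoint[OF T, symmetric])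
    show "?T (c *\<^sub>C x) = c *\<^sub>C ?T x" for c x
      by (rule cinner_eqI) (simp add: cinner_scaleC_right cinner_adjoint[OF T, symmetric])
    show "norm (?T x) \<le> K * norm x" for x
    proof (cases "?T x = 0")
      case False
      have "(norm (?T x))\<^sup>2 = cmod (cinner (?T x) (?T x))"
        by (simp only: cinner_self norm_of_real abs_power2 abs_norm_cancel power_abs)
      also have "\<dots> = cmod (cinner (T (?T x)) x)"
        by (simp add: cinner_adjoint[OF T])
      also have "\<dots> \<le> norm (T (?T x)) * norm x" by (rule cmod_cinner_le)
      also have "\<dots> \<le> (K * norm (?T x)) * norm x" by (intro mult_right_mono K(2)) simp
      finally show ?thesis using False by (simp add: power2_eq_square)
    qed (use K in simp)
  qed auto
qed

lemma operator_on_adjoint_invariant_ortho: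
  assumes T: "operator_on UNIV T" and "\<And>x. x \<in> M \<Longrightarrow> adjoint_on UNIV T x \<in> M" "x \<in> UNIV \<ominus> M"
  shows "T x \<in> UNIV \<ominus> M"
  using assms(2,3) by (auto simp: ortho_diff_def cinner_adjoint[OF T])

lemma reduces_UNIV_iff:
  assumes T: "operator_on UNIV T"
  shows "reduces UNIV M T \<longleftrightarrow>
    closed_csubspace M \<and> (\<forall>x\<in>M. T x \<in> M \<and> adjoint_on UNIV T x \<in> M)"
proof safe
  assume R: "reduces UNIV M T"
  then show M: "closed_csubspace M"
    by (auto simp: reduces_def)
  show "T x \<in> M" if "x \<in> M" for x
    using R that by (auto simp: reduces_def)
  show "adjoint_on UNIV T x \<in> M" if "x \<in> M" for x
  proof -
    have "cinner (adjoint_on UNIV T x) y = 0" if y: "y \<in> UNIV \<ominus> M" for y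
    proof -
      have "T y \<in> UNIV \<ominus> M" using R y by (auto simp: reduces_def)
      then have "cinner (T y) x = 0" using \<open>x \<in> M\<close> by (auto simp: ortho_diff_def)
      then have "cinner y (adjoint_on UNIV T x) = 0" by (simp add: cinner_adjoint[OF T])
      then show ?thesis by (metis cinner_commute complex_cnj_zero)
    qed
    then have "adjoint_on UNIV T x \<in> UNIV \<ominus> (UNIV \<ominus> M)"
      by (auto simp: ortho_diff_def)
    then show ?thesis using ortho_ortho[OF M] by simp
  qed
next
  assume "closed_csubspace M" "\<forall>x\<in>M. T x \<in> M \<and> adjoint_on UNIV T x \<in> M"
  then show "reduces UNIV M T"
    using operator_on_adjoint_invariant_ortho[OF T] by (auto simp: reduces_def)
qed

lemma reduces_ortho:
  assumes "reduces UNIV M T"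
  shows "reduces UNIV (UNIV \<ominus> M) T"
  using assms ortho_ortho[of M] by (auto simp: reduces_def closed_csubspace_ortho)

lemma orth_proj_commute:
  assumes T: "operator_on UNIV T" and R: "reduces UNIV M T"
  shows "orth_proj M (T x) = T (orth_proj M x)"
proof -
  have M: "closed_csubspace M" using R by (simp add: reduces_def)
  have "T x - T (orth_proj M x) = T (x - orth_proj M x)"
    using operator_on_diff[OF T closed_csubspace_UNIV] by simp
  then show ?thesis
    using R orth_proj[OF M, of x] by (intro orth_proj_eqI[OF M]) (auto simp: reduces_def)
qed

lemma adjoint_on_reducing:
  assumes T: "operator_on UNIV T" and R: "reduces UNIV M T" and x: "x \<in> M"
  shows "adjoint_on M T x = adjoint_on UNIV T x"
  using R x unfolding reduces_UNIV_iff[OF T]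
  by (intro adjoint_on_eqI) (auto simp: cinner_adjoint[OF T])

section \<open>The unitary part of a contraction\<close>

lemma adjoint_contraction:
  assumes T: "operator_on UNIV T" and C: "\<And>x. norm (T x) \<le> norm x"
  shows "norm (adjoint_on UNIV T y) \<le> norm y"
proof (cases "adjoint_on UNIV T y = 0")
  case False
  let ?z = "adjoint_on UNIV T y"
  have "(norm ?z)\<^sup>2 = cmod (cinner (T ?z) y)"
    by (simp only: cinner_adjoint[OF T] cinner_self norm_of_real abs_power2 abs_norm_cancel power_abs)
  also have "\<dots> \<le> norm (T ?z) * norm y" by (rule cmod_cinner_le)
  also have "\<dots> \<le> norm ?z * norm y" by (intro mult_right_mono C) simp
  finally show ?thesis using False by (simp add: power2_eq_square)
qed simp

text \<open>Equality in \<open>\<parallel>T x\<parallel> \<le> \<parallel>x\<parallel>\<close> is a linear condition: expanding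
  \<open>\<parallel>S T x - x\<parallel>\<^sup>2\<close> for \<open>S = T\<^sup>*\<close> gives at most \<open>\<parallel>x\<parallel>\<^sup>2 - 2\<parallel>T x\<parallel>\<^sup>2 + \<parallel>x\<parallel>\<^sup>2\<close>.\<close>

lemma contraction_norm_eq_iff:
  assumes adj: "\<And>x y. cinner (T x) y = cinner x (S y)"
    and T: "\<And>x. norm (T x) \<le> norm x" and S: "\<And>x. norm (S x) \<le> norm x"
  shows "norm (T x) = norm x \<longleftrightarrow> S (T x) = x"
proof
  have *: "cinner x (S (T x)) = of_real ((norm (T x))\<^sup>2)"
    by (simp only: adj[symmetric] cinner_self)
  {
    assume eq: "norm (T x) = norm x"
    have "norm (S (T x)) \<le> norm x"
      using S[of "T x"] T[of x] by (rule order_trans)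
    then have "(norm (S (T x)))\<^sup>2 \<le> (norm x)\<^sup>2" by (intro power_mono) auto
    moreover have "(norm (x - S (T x)))\<^sup>2 = (norm x)\<^sup>2 + (norm (S (T x)))\<^sup>2 - 2 * (norm x)\<^sup>2"
      unfolding norm_diff_square * eq by simp
    ultimately have "(norm (x - S (T x)))\<^sup>2 \<le> 0" by simp
    then show "S (T x) = x" by simp
  }
  assume "S (T x) = x"
  then have "complex_of_real ((norm x)\<^sup>2) = of_real ((norm (T x))\<^sup>2)"
    using * cinner_self[of x] by simp
  then have "(norm x)\<^sup>2 = (norm (T x))\<^sup>2" using of_real_eq_iff by blast
  then show "norm (T x) = norm x" by simp
qed

lemma operator_on_funpow:
  assumes "operator_on M T"
  shows "operator_on M (T ^^ n)"
proof (induction n)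
  case 0
  show ?case using operator_on_id[of M] by (simp add: id_def)
next
  case (Suc n)
  show ?case using operator_on_compose[OF assms Suc] by (simp add: o_def)
qed

text \<open>The pointwise form of the unitary part of a contraction. It is the witness for the existence
  of a largest reducing subspace on which \<open>P\<close> is unitary.\<close>

definition isometric_part :: "('a::complex_hilbert \<Rightarrow> 'a) \<Rightarrow> 'a set" where
  "isometric_part P = {h. \<forall>n. norm ((P ^^ n) h) = norm h \<and> norm ((adjoint_on UNIV P ^^ n) h) = norm h}"

text \<open>Along an orbit that stays in \<open>S\<close>, norm preservation passes from one application to all powers.
  Membership can thus be tested without computing powers.\<close>

lemma isometric_part_coinduct:
  assumes "\<And>x. x \<in> S \<Longrightarrow> P x \<in> S \<and> adjoint_on UNIV P x \<in> S
      \<and> norm (P x) = norm x \<and> norm (adjoint_on UNIV P x) = norm x"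
  shows "S \<subseteq> isometric_part P"
proof
  fix x assume "x \<in> S"
  have "(P ^^ n) x \<in> S \<and> norm ((P ^^ n) x) = norm x" for n
    using \<open>x \<in> S\<close> assms by (induction n) auto
  moreover have "(adjoint_on UNIV P ^^ n) x \<in> S \<and> norm ((adjoint_on UNIV P ^^ n) x) = norm x" for n
    using \<open>x \<in> S\<close> assms by (induction n) auto
  ultimately show "x \<in> isometric_part P" by (simp add: isometric_part_def)
qed

context
  fixes P :: "'a::complex_hilbert \<Rightarrow> 'a"
  assumes P: "operator_on UNIV P" and contr: "\<And>x. norm (P x) \<le> norm x"
begin

abbreviation (input) adjoint_P :: "'a \<Rightarrow> 'a" where "adjoint_P \<equiv> adjoint_on UNIV P"

lemma funpow_contraction: "norm ((P ^^ n) x) \<le> norm x" "norm ((adjoint_P ^^ n) x) \<le> norm x"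
  by (induction n) (auto intro: order_trans contr adjoint_contraction[OF P contr])

lemma funpow_adjoint: "cinner ((P ^^ n) x) y = cinner x ((adjoint_P ^^ n) y)"
proof (induction n arbitrary: y)
  case (Suc n)
  then show ?case by (simp add: cinner_adjoint[OF P] funpow_swap1[of adjoint_P])
qed simp

lemma funpow_adjoint': "cinner ((adjoint_P ^^ n) x) y = cinner x ((P ^^ n) y)"
  by (metis cinner_commute funpow_adjoint)

lemma norm_eq_iff_adjoint:
  "norm (P x) = norm x \<longleftrightarrow> adjoint_P (P x) = x"
  "norm (adjoint_P x) = norm x \<longleftrightarrow> P (adjoint_P x) = x"
  using contraction_norm_eq_iff[OF funpow_adjoint funpow_contraction, of 1 x]
    contraction_norm_eq_iff[OF funpow_adjoint' funpow_contraction(2,1), of 1 x] by simp_all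

text \<open>Norm preservation is not visibly linear, but by the equality case it is a family of
  fixed point equations of bounded operators. So the isometric part is a closed subspace.\<close>

lemma isometric_part_iff:
  "h \<in> isometric_part P \<longleftrightarrow>
     (\<forall>n. (adjoint_P ^^ n) ((P ^^ n) h) = h \<and> (P ^^ n) ((adjoint_P ^^ n) h) = h)"
  unfolding isometric_part_def
  using contraction_norm_eq_iff[OF funpow_adjoint funpow_contraction]
    contraction_norm_eq_iff[OF funpow_adjoint' funpow_contraction(2,1)] by simp

lemma isometric_part_adjoint_cancel:
  assumes "h \<in> isometric_part P"
  shows "adjoint_P (P h) = h" "P (adjoint_P h) = h"
  using assms[unfolded isometric_part_iff, rule_format, of 1] by auto

lemma isometric_part_closed_csubspace: "closed_csubspace (isometric_part P)"
proof -
  note Q = operator_on_adjoint[OF P]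
  have lin: "operator_on UNIV (P ^^ n)" "operator_on UNIV (adjoint_P ^^ n)" for n
    by (rule operator_on_funpow[OF P], rule operator_on_funpow[OF Q])
  have lin2: "operator_on UNIV (\<lambda>h. (adjoint_P ^^ n) ((P ^^ n) h))"
      "operator_on UNIV (\<lambda>h. (P ^^ n) ((adjoint_P ^^ n) h))" for n
    by (rule operator_on_compose[OF lin(2,1)], rule operator_on_compose[OF lin])
  have fix_closed: "closed {h. T h = h}" if "operator_on UNIV T" for T :: "'a \<Rightarrow> 'a"
    by (intro closed_Collect_eq continuous_on_id linear_continuous_on bounded_linear_operator[OF that])
  have "isometric_part P = (\<Inter>n. {h. (adjoint_P ^^ n) ((P ^^ n) h) = h}
      \<inter> {h. (P ^^ n) ((adjoint_P ^^ n) h) = h})"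
    by (auto simp: isometric_part_iff)
  moreover have "closed \<dots>"
    by (intro closed_INT ballI closed_Int fix_closed lin2)
  ultimately have "closed (isometric_part P)" by simp
  moreover have "0 \<in> isometric_part P"
    using operator_on_zero[OF lin2(1) closed_csubspace_UNIV]
      operator_on_zero[OF lin2(2) closed_csubspace_UNIV] by (simp add: isometric_part_iff)
  ultimately show ?thesis
    unfolding closed_csubspace_def
    by (simp add: isometric_part_iff operator_onD(2,3)[OF lin2(1)] operator_onD(2,3)[OF lin2(2)]
        operator_onD(2,3)[OF lin(1)] operator_onD(2,3)[OF lin(2)])
qed

lemma isometric_part_invariant:
  assumes h: "h \<in> isometric_part P"
  shows "P h \<in> isometric_part P" "adjoint_P h \<in> isometric_part P"
proof -
  note hn = h[unfolded isometric_part_def, simplified, rule_format]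
  note cancel = isometric_part_adjoint_cancel[OF h]
  have h1: "norm (P h) = norm h" "norm (adjoint_P h) = norm h"
    using hn[of 1] by simp_all
  have "norm ((P ^^ n) (P h)) = norm h" "norm ((adjoint_P ^^ n) (adjoint_P h)) = norm h" for n
    using hn[of "Suc n"] by (simp_all only: funpow_Suc_right o_apply)
  moreover have "norm ((adjoint_P ^^ n) (P h)) = norm h" "norm ((P ^^ n) (adjoint_P h)) = norm h" for n
  proof -
    show "norm ((adjoint_P ^^ n) (P h)) = norm h"
      using hn[of "n - 1"] h1 cancel by (cases n) (simp_all del: funpow.simps(2) add: funpow_Suc_right)
    show "norm ((P ^^ n) (adjoint_P h)) = norm h"
      using hn[of "n - 1"] h1 cancel by (cases n) (simp_all del: funpow.simps(2) add: funpow_Suc_right)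
  qed
  ultimately show "P h \<in> isometric_part P" "adjoint_P h \<in> isometric_part P"
    unfolding isometric_part_def h1 mem_Collect_eq by blast+
qed

lemma isometric_part_reduces: "reduces UNIV (isometric_part P) P"
  unfolding reduces_UNIV_iff[OF P]
  using isometric_part_closed_csubspace isometric_part_invariant by blast

lemma isometric_part_unitary: "unitary_on (isometric_part P) P"
  unfolding unitary_on_def
proof (intro conjI ballI)
  show "operator_on (isometric_part P) P"
    by (rule operator_on_subset[OF P subset_UNIV isometric_part_invariant(1)])
next
  fix h assume h: "h \<in> isometric_part P"
  note adj = adjoint_on_reducing[OF P isometric_part_reduces]
  show "adjoint_on (isometric_part P) P (P h) = h" "P (adjoint_on (isometric_part P) P h) = h"
    unfolding adj[OF h] adj[OF isometric_part_invariant(1)[OF h]]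
    by (fact isometric_part_adjoint_cancel[OF h])+
qed

lemma isometric_part_maximal:
  assumes N: "reduces UNIV N P" "unitary_on N P"
  shows "N \<subseteq> isometric_part P"
proof (rule isometric_part_coinduct)
  fix x assume x: "x \<in> N"
  have inv: "P x \<in> N" "adjoint_P x \<in> N"
    using N(1) x by (auto simp: reduces_UNIV_iff[OF P])
  have "adjoint_P (P x) = x" "P (adjoint_P x) = x"
    using N(2) x unfolding unitary_on_def
      adjoint_on_reducing[OF P N(1) x, symmetric] adjoint_on_reducing[OF P N(1) inv(1), symmetric]
    by blast+
  then show "P x \<in> N \<and> adjoint_P x \<in> N \<and> norm (P x) = norm x \<and> norm (adjoint_P x) = norm x"
    unfolding norm_eq_iff_adjoint using inv by blast
qed

lemma unitary_part_eq_isometric_part: "unitary_part UNIV P = isometric_part P"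
  unfolding unitary_part_def
  by (rule Greatest_equality)
    (simp add: isometric_part_reduces isometric_part_unitary, rule isometric_part_maximal, simp_all)

end

section \<open>Polynomial calculus and spectral sets\<close>

lemma quotient_le_onorm_on:
  assumes "operator_on M T" "x \<in> M"
  shows "norm (T x) / norm x \<le> onorm_on M T"
proof -
  obtain K where K: "K > 0" "\<And>x. x \<in> M \<Longrightarrow> norm (T x) \<le> K * norm x"
    using operator_on_bound[OF assms(1)] by blast
  have "bdd_above ((\<lambda>x. norm (T x) / norm x) ` M)"
  proof (rule bdd_aboveI2)
    show "norm (T y) / norm y \<le> K" if "y \<in> M" for y
      using K(1) K(2)[OF that] by (cases "norm y = 0") (auto simp: divide_le_eq)
  qed
  then show ?thesis
    unfolding onorm_on_def by (intro cSUP_upper assms(2))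
qed

lemma onorm_on_le:
  assumes "operator_on M T" "x \<in> M"
  shows "norm (T x) \<le> onorm_on M T * norm x"
proof (cases "norm x = 0")
  case True
  obtain K where "norm (T x) \<le> K * norm x"
    using operator_on_bound[OF assms(1)] assms(2) by blast
  then show ?thesis using True by simp
next
  case False
  then show ?thesis using quotient_le_onorm_on[OF assms] by (simp add: divide_le_eq)
qed

lemma onorm_on_least:
  assumes "M \<noteq> {}" "K \<ge> 0" "\<And>x. x \<in> M \<Longrightarrow> norm (T x) \<le> K * norm x"
  shows "onorm_on M T \<le> K"
  unfolding onorm_on_def
proof (rule cSUP_least[OF assms(1)])
  show "norm (T x) / norm x \<le> K" if "x \<in> M" for x
    using assms(2) assms(3)[OF that] by (cases "norm x = 0") (auto simp: divide_le_eq)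
qed

lemma onorm_on_nonneg:
  assumes "operator_on M T" "0 \<in> M"
  shows "0 \<le> onorm_on M T"
  using quotient_le_onorm_on[OF assms] by simp

lemma operator_on_sum:
  assumes "closed_csubspace M" "finite I" "\<And>i. i \<in> I \<Longrightarrow> operator_on M (F i)"
  shows "operator_on M (\<lambda>x. \<Sum>i\<in>I. F i x)"
  using assms(2,3)
proof (induction I rule: finite_induct)
  case empty
  then show ?case
    using closed_csubspaceD(2)[OF assms(1)] by (intro operator_onI[where K = 0]) auto
next
  case (insert i I)
  then show ?case using operator_on_add[OF assms(1), of "F i"] by simp
qed

lemma operator_on_eval3_op:
  assumes M: "closed_csubspace M" and "operator_on M A" "operator_on M B" "operator_on M P"
  shows "operator_on M (eval3_op p A B P)"
proof -
  have "operator_on M (\<lambda>h. c *\<^sub>C (A ^^ i) ((B ^^ j) ((P ^^ k) h)))" for c i j k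
    by (rule operator_on_scale[OF M operator_on_compose[OF operator_on_funpow[OF assms(2)]
          operator_on_compose[OF operator_on_funpow[OF assms(3)] operator_on_funpow[OF assms(4)]]]])
  then have "operator_on M (\<lambda>h. \<Sum>e\<in>Poly_Mapping.keys p. Poly_Mapping.lookup p (fst e, fst (snd e), snd (snd e))
      *\<^sub>C (A ^^ fst e) ((B ^^ fst (snd e)) ((P ^^ snd (snd e)) h)))"
    by (intro operator_on_sum[OF M]) simp_all
  then show ?thesis by (simp add: eval3_op_def[abs_def] case_prod_unfold)
qed

lemma eval3_binomial:
  assumes "(i, j, k) \<noteq> (l, m, n)"
  shows "eval3 (Poly_Mapping.single (i, j, k) \<alpha> + Poly_Mapping.single (l, m, n) \<beta>) (x, y, z)
    = \<alpha> * (x ^ i * y ^ j * z ^ k) + \<beta> * (x ^ l * y ^ m * z ^ n)"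
proof -
  let ?p = "Poly_Mapping.single (i, j, k) \<alpha> + Poly_Mapping.single (l, m, n) \<beta>"
  have "Poly_Mapping.keys ?p \<subseteq> {(i, j, k), (l, m, n)}"
    using Poly_Mapping.keys_add[of "Poly_Mapping.single (i, j, k) \<alpha>"] by (fastforce split: if_splits)
  then have "eval3 ?p (x, y, z) = (\<Sum>(i, j, k)\<in>{(i, j, k), (l, m, n)}.
      Poly_Mapping.lookup ?p (i, j, k) * (x ^ i * y ^ j * z ^ k))"
    unfolding eval3_def prod.case
    by (intro sum.mono_neutral_left) (auto simp: in_keys_iff)
  also have "\<dots> = \<alpha> * (x ^ i * y ^ j * z ^ k) + \<beta> * (x ^ l * y ^ m * z ^ n)"
    using assms by (auto simp: lookup_add lookup_single when_def)
  finally show ?thesis .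
qed

lemma eval3_op_binomial:
  assumes "(i, j, k) \<noteq> (l, m, n)"
  shows "eval3_op (Poly_Mapping.single (i, j, k) \<alpha> + Poly_Mapping.single (l, m, n) \<beta>) A B P h
    = \<alpha> *\<^sub>C (A ^^ i) ((B ^^ j) ((P ^^ k) h)) + \<beta> *\<^sub>C (A ^^ l) ((B ^^ m) ((P ^^ n) h))"
proof -
  let ?p = "Poly_Mapping.single (i, j, k) \<alpha> + Poly_Mapping.single (l, m, n) \<beta>"
  have "Poly_Mapping.keys ?p \<subseteq> {(i, j, k), (l, m, n)}"
    using Poly_Mapping.keys_add[of "Poly_Mapping.single (i, j, k) \<alpha>"] by (fastforce split: if_splits)
  then have "eval3_op ?p A B P h = (\<Sum>(i, j, k)\<in>{(i, j, k), (l, m, n)}.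
      Poly_Mapping.lookup ?p (i, j, k) *\<^sub>C (A ^^ i) ((B ^^ j) ((P ^^ k) h)))"
    unfolding eval3_op_def prod.case
    by (intro sum.mono_neutral_left) (auto simp: in_keys_iff)
  also have "\<dots> = \<alpha> *\<^sub>C (A ^^ i) ((B ^^ j) ((P ^^ k) h)) + \<beta> *\<^sub>C (A ^^ l) ((B ^^ m) ((P ^^ n) h))"
    using assms by (auto simp: lookup_add lookup_single when_def)
  finally show ?thesis .
qed

lemma inv_into_eq_inverse:
  assumes S: "operator_on M S" "\<And>x. x \<in> M \<Longrightarrow> S (T x) = x \<and> T (S x) = x" and x: "x \<in> M"
  shows "inv_into M T x = S x"
proof -
  have "inj_on T M" using S(2) by (metis inj_onI)
  then show ?thesis
    using S x operator_onD(1)[OF S(1)] by (metis inv_into_f_f)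
qed

text \<open>Applied to \<open>h = q(A, B, P) k\<close>, the norm bound on \<open>p(A, B, P) q(A, B, P)\<^sup>-\<^sup>1 h\<close> becomes an
  inequality free of inverses.\<close>

lemma spectral_set_norm_le:
  assumes X: "spectral_set_on X M A B P" "X \<noteq> {}"
    and q: "\<And>x. x \<in> X \<Longrightarrow> eval3 q x \<noteq> 0"
    and pq: "\<And>x. x \<in> X \<Longrightarrow> cmod (eval3 p x) \<le> cmod (eval3 q x)"
    and k: "k \<in> M"
  shows "norm (eval3_op p A B P k) \<le> norm (eval3_op q A B P k)"
proof -
  let ?p = "eval3_op p A B P" and ?q = "eval3_op q A B P"
  let ?r = "\<lambda>h. ?p (inv_into M ?q h)"
  have M: "closed_csubspace M" and ops: "operator_on M A" "operator_on M B" "operator_on M P"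
    using X by (auto simp: spectral_set_on_def commuting_triple_on_def)
  have inv: "invertible_on M ?q" and le: "onorm_on M ?r \<le> (SUP x\<in>X. norm (eval3 p x / eval3 q x))"
    using X q unfolding spectral_set_on_def by auto
  obtain S where S: "operator_on M S" "\<And>x. x \<in> M \<Longrightarrow> S (?q x) = x \<and> ?q (S x) = x"
    using inv unfolding invertible_on_def by blast
  have "(SUP x\<in>X. norm (eval3 p x / eval3 q x)) \<le> 1"
    using q pq by (intro cSUP_least[OF X(2)]) (simp add: norm_divide divide_le_eq)
  then have le1: "onorm_on M ?r \<le> 1" using le by simp
  have r: "?r h = ?p (S h)" if "h \<in> M" for h
    using inv_into_eq_inverse[OF S that] by simp
  have "operator_on M (\<lambda>h. ?p (S h))"
    by (rule operator_on_compose[OF operator_on_eval3_op[OF M ops] S(1)])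
  then have op_r: "operator_on M ?r"
    unfolding operator_on_def using r closed_csubspaceD(3,4)[OF M] by (simp add: operator_on_def)
  have qk: "?q k \<in> M"
    using operator_onD(1)[OF operator_on_eval3_op[OF M ops] k] .
  have "norm (?p k) = norm (?r (?q k))"
    using r[OF qk] S(2)[OF k] by simp
  also have "\<dots> \<le> onorm_on M ?r * norm (?q k)"
    by (rule onorm_on_le[OF op_r qk])
  also have "\<dots> \<le> norm (?q k)"
    using mult_right_mono[OF le1, of "norm (?q k)"] by simp
  finally show ?thesis .
qed

section \<open>Norm inequalities for tetrablock contractions\<close>

lemma tetrablock_bounds:
  assumes "(x1, x2, x3) \<in> tetrablock"
  shows "cmod x1 \<le> 1" "cmod x2 \<le> 1"
    "cmod z \<le> 1 \<Longrightarrow> cmod (x1 - z * x3) \<le> cmod (1 - z * x2)"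
    "cmod z \<le> 1 \<Longrightarrow> cmod (x2 - z * x3) \<le> cmod (1 - z * x1)"
proof -
  have nz: "1 - z * x1 - w * x2 + z * w * x3 \<noteq> 0" if "cmod z \<le> 1" "cmod w \<le> 1" for z w
    using assms that by (auto simp: tetrablock_def)
  show "cmod x1 \<le> 1"
  proof (rule ccontr)
    assume *: "\<not> cmod x1 \<le> 1"
    then have "x1 \<noteq> 0" by auto
    moreover have "cmod (1 / x1) \<le> 1" using * by (simp add: norm_divide divide_le_eq)
    ultimately show False using nz[of "1 / x1" 0] by simp
  qed
  show "cmod x2 \<le> 1"
  proof (rule ccontr)
    assume *: "\<not> cmod x2 \<le> 1"
    then have "x2 \<noteq> 0" by auto
    moreover have "cmod (1 / x2) \<le> 1" using * by (simp add: norm_divide divide_le_eq)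
    ultimately show False using nz[of 0 "1 / x2"] by simp
  qed
  \<comment> \<open>Otherwise solving the defining equation for the other variable gives a zero in the bidisc.\<close>
  show "cmod (x1 - z * x3) \<le> cmod (1 - z * x2)" if "cmod z \<le> 1"
  proof (rule ccontr)
    assume *: "\<not> cmod (x1 - z * x3) \<le> cmod (1 - z * x2)"
    define v where "v = (1 - z * x2) / (x1 - z * x3)"
    have "x1 - z * x3 \<noteq> 0" using * by auto
    then have "v * (x1 - z * x3) = 1 - z * x2" by (simp add: v_def)
    then have "1 - v * x1 - z * x2 + v * z * x3 = 0" by (simp add: algebra_simps)
    moreover have "cmod v \<le> 1" using * by (auto simp: v_def norm_divide divide_le_eq)
    ultimately show False using nz that by blast
  qed
  show "cmod (x2 - z * x3) \<le> cmod (1 - z * x1)" if "cmod z \<le> 1"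
  proof (rule ccontr)
    assume *: "\<not> cmod (x2 - z * x3) \<le> cmod (1 - z * x1)"
    define v where "v = (1 - z * x1) / (x2 - z * x3)"
    have "x2 - z * x3 \<noteq> 0" using * by auto
    then have "v * (x2 - z * x3) = 1 - z * x1" by (simp add: v_def)
    then have "1 - z * x1 - v * x2 + z * v * x3 = 0" by (simp add: algebra_simps)
    moreover have "cmod v \<le> 1" using * by (auto simp: v_def norm_divide divide_le_eq)
    ultimately show False using nz that by blast
  qed
qed

lemma closure_tetrablock_bounds:
  assumes "(x1, x2, x3) \<in> closure tetrablock"
  shows "cmod x1 \<le> 1" "cmod x2 \<le> 1"
    "cmod z \<le> 1 \<Longrightarrow> cmod (x1 - z * x3) \<le> cmod (1 - z * x2)"
    "cmod z \<le> 1 \<Longrightarrow> cmod (x2 - z * x3) \<le> cmod (1 - z * x1)"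
proof -
  have transfer: "f (x1, x2, x3) \<le> g (x1, x2, x3)"
    if "continuous_on UNIV f" "continuous_on UNIV g" "\<And>a b c. (a, b, c) \<in> tetrablock \<Longrightarrow> f (a, b, c) \<le> g (a, b, c)"
    for f g :: "complex \<times> complex \<times> complex \<Rightarrow> real"
  proof -
    have "tetrablock \<subseteq> {x. f x \<le> g x}" using that(3) by auto
    moreover have "closed {x. f x \<le> g x}" by (intro closed_Collect_le that)
    ultimately have "closure tetrablock \<subseteq> {x. f x \<le> g x}" by (rule closure_minimal)
    then show ?thesis using assms by blast
  qed
  show "cmod x1 \<le> 1"
    by (rule transfer[of "\<lambda>x. cmod (fst x)" "\<lambda>_. 1", unfolded fst_conv snd_conv])
      ((intro continuous_intros)+, rule tetrablock_bounds(1))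
  show "cmod x2 \<le> 1"
    by (rule transfer[of "\<lambda>x. cmod (fst (snd x))" "\<lambda>_. 1", unfolded fst_conv snd_conv])
      ((intro continuous_intros)+, rule tetrablock_bounds(2))
  show "cmod (x1 - z * x3) \<le> cmod (1 - z * x2)" if "cmod z \<le> 1"
    by (rule transfer[of "\<lambda>x. cmod (fst x - z * snd (snd x))" "\<lambda>x. cmod (1 - z * fst (snd x))",
          unfolded fst_conv snd_conv])
      ((intro continuous_intros)+, rule tetrablock_bounds(3)[OF _ that])
  show "cmod (x2 - z * x3) \<le> cmod (1 - z * x1)" if "cmod z \<le> 1"
    by (rule transfer[of "\<lambda>x. cmod (fst (snd x) - z * snd (snd x))" "\<lambda>x. cmod (1 - z * fst x)",
          unfolded fst_conv snd_conv])
      ((intro continuous_intros)+, rule tetrablock_bounds(4)[OF _ that])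
qed

lemma closure_tetrablock_nonempty: "closure tetrablock \<noteq> {}"
proof -
  have "(0, 0, 0) \<in> tetrablock" by (simp add: tetrablock_def)
  then show ?thesis using closure_subset by blast
qed

text \<open>The rational function \<open>(x\<^sub>1 - z x\<^sub>3) / (1 - z x\<^sub>2)\<close> and its mirror image
  are bounded by one on the closed tetrablock. Their denominators may vanish there when
  \<open>\<bar>z\<bar> = 1\<close>, so the spectral set inequality is used inside the disc and passed to the limit.\<close>

lemma tetrablock_contraction_norm_le:
  assumes E: "tetrablock_contraction_on UNIV A B P" and w: "cmod w = 1"
  shows "norm (A h - w *\<^sub>C P h) \<le> norm (h - w *\<^sub>C B h)"
    and "norm (B h - w *\<^sub>C P h) \<le> norm (h - w *\<^sub>C A h)"
proof -
  note X = E[unfolded tetrablock_contraction_on_def]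
  have nz: "z * y \<noteq> 1" if "cmod z < 1" "cmod y \<le> 1" for z y :: complex
  proof
    assume "z * y = 1"
    then have "cmod z * cmod y = 1" by (metis norm_mult norm_one)
    moreover have "cmod z * cmod y \<le> cmod z * 1" using that by (intro mult_left_mono) auto
    ultimately show False using that by simp
  qed
  have in1: "norm (A h - z *\<^sub>C P h) \<le> norm (h - z *\<^sub>C B h)" if z: "cmod z < 1" for z
  proof -
    let ?p = "Poly_Mapping.single (1, 0, 0) 1 + Poly_Mapping.single (0, 0, 1) (- z)"
    let ?q = "Poly_Mapping.single (0, 0, 0) 1 + Poly_Mapping.single (0, 1, 0) (- z)"
    have "norm (eval3_op ?p A B P h) \<le> norm (eval3_op ?q A B P h)"
    proof (rule spectral_set_norm_le[OF X closure_tetrablock_nonempty])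
      fix x assume "x \<in> closure tetrablock"
      then obtain x1 x2 x3 where x: "x = (x1, x2, x3)" "(x1, x2, x3) \<in> closure tetrablock"
        by (metis prod_cases3)
      note bounds = closure_tetrablock_bounds[OF x(2)]
      show "eval3 ?q x \<noteq> 0" "cmod (eval3 ?p x) \<le> cmod (eval3 ?q x)"
        unfolding x(1) using nz[OF z bounds(1)] nz[OF z bounds(2)] bounds(3,4)[of z] z
        by (simp_all add: eval3_binomial)
    qed simp
    then show ?thesis by (simp add: eval3_op_binomial scaleC_minus_left)
  qed
  have in2: "norm (B h - z *\<^sub>C P h) \<le> norm (h - z *\<^sub>C A h)" if z: "cmod z < 1" for z
  proof -
    let ?p = "Poly_Mapping.single (0, 1, 0) 1 + Poly_Mapping.single (0, 0, 1) (- z)"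
    let ?q = "Poly_Mapping.single (0, 0, 0) 1 + Poly_Mapping.single (1, 0, 0) (- z)"
    have "norm (eval3_op ?p A B P h) \<le> norm (eval3_op ?q A B P h)"
    proof (rule spectral_set_norm_le[OF X closure_tetrablock_nonempty])
      fix x assume "x \<in> closure tetrablock"
      then obtain x1 x2 x3 where x: "x = (x1, x2, x3)" "(x1, x2, x3) \<in> closure tetrablock"
        by (metis prod_cases3)
      note bounds = closure_tetrablock_bounds[OF x(2)]
      show "eval3 ?q x \<noteq> 0" "cmod (eval3 ?p x) \<le> cmod (eval3 ?q x)"
        unfolding x(1) using nz[OF z bounds(1)] nz[OF z bounds(2)] bounds(3,4)[of z] z
        by (simp_all add: eval3_binomial)
    qed simp
    then show ?thesis by (simp add: eval3_op_binomial scaleC_minus_left)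
  qed
  have limit: "norm (a - w *\<^sub>C b) \<le> norm (c - w *\<^sub>C d)"
    if *: "\<And>z. cmod z < 1 \<Longrightarrow> norm (a - z *\<^sub>C b) \<le> norm (c - z *\<^sub>C d)" for a b c d :: 'a
  proof -
    have t: "((\<lambda>r. norm (x - r *\<^sub>R w *\<^sub>C y)) \<longlongrightarrow> norm (x - 1 *\<^sub>R w *\<^sub>C y)) (at_left (1::real))" for x y :: 'a
      by (intro tendsto_intros)
    have "\<forall>\<^sub>F r in at_left (1::real). norm (a - r *\<^sub>R w *\<^sub>C b) \<le> norm (c - r *\<^sub>R w *\<^sub>C d)"
    proof (rule eventually_at_leftI[of 0])
      fix r :: real assume "r \<in> {0<..<1}"
      then have "cmod (of_real r * w) < 1" using w by (simp add: norm_mult)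
      from *[OF this] show "norm (a - r *\<^sub>R w *\<^sub>C b) \<le> norm (c - r *\<^sub>R w *\<^sub>C d)"
        by (simp add: scaleC_scaleC[symmetric] scaleC_of_real)
    qed simp
    then show ?thesis
      using tendsto_le[OF trivial_limit_at_left_real t t] by fastforce
  qed
  show "norm (A h - w *\<^sub>C P h) \<le> norm (h - w *\<^sub>C B h)"
    "norm (B h - w *\<^sub>C P h) \<le> norm (h - w *\<^sub>C A h)"
    by (intro limit in1 in2; assumption)+
qed

text \<open>Squaring the two inequalities bounds \<open>2 Re (v (\<langle>h, B h\<rangle> - \<langle>A h, P h\<rangle>))\<close> by
  \<open>\<parallel>h\<parallel>\<^sup>2 - \<parallel>P h\<parallel>\<^sup>2 + \<parallel>B h\<parallel>\<^sup>2 - \<parallel>A h\<parallel>\<^sup>2\<close>, and the same with \<open>A\<close> and \<open>B\<close> exchanged. The average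
  of the latter over \<open>v\<close> and \<open>-v\<close> bounds zero; added to the former it cancels the last two terms.\<close>

lemma tetrablock_contraction_form_le:
  assumes E: "tetrablock_contraction_on UNIV A B P" and v: "cmod v = 1"
  shows "Re (v * (cinner h (B h) - cinner (A h) (P h))) \<le> (norm h)\<^sup>2 - (norm (P h))\<^sup>2"
    and "Re (v * (cinner h (A h) - cinner (B h) (P h))) \<le> (norm h)\<^sup>2 - (norm (P h))\<^sup>2"
proof -
  have square: "2 * Re (w * (cinner h y - cinner x p)) \<le> (norm h)\<^sup>2 - (norm p)\<^sup>2 + (norm y)\<^sup>2 - (norm x)\<^sup>2"
    if "cmod w = 1" "norm (x - cnj w *\<^sub>C p) \<le> norm (h - cnj w *\<^sub>C y)" for w x y p
  proof -
    have "(norm (x - cnj w *\<^sub>C p))\<^sup>2 \<le> (norm (h - cnj w *\<^sub>C y))\<^sup>2"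
      using that(2) by (intro power_mono) auto
    then show ?thesis
      using that(1) by (simp add: norm_diff_square cinner_scaleC_right algebra_simps)
  qed
  have b: "2 * Re (w * (cinner h (B h) - cinner (A h) (P h)))
        \<le> (norm h)\<^sup>2 - (norm (P h))\<^sup>2 + (norm (B h))\<^sup>2 - (norm (A h))\<^sup>2"
    and a: "2 * Re (w * (cinner h (A h) - cinner (B h) (P h)))
        \<le> (norm h)\<^sup>2 - (norm (P h))\<^sup>2 + (norm (A h))\<^sup>2 - (norm (B h))\<^sup>2" if "cmod w = 1" for w
    using that tetrablock_contraction_norm_le[OF E, of "cnj w"]
    by (intro square[OF that]; simp)+
  show "Re (v * (cinner h (B h) - cinner (A h) (P h))) \<le> (norm h)\<^sup>2 - (norm (P h))\<^sup>2"
    using b[OF v] a[of 1] a[of "-1"] by (simp only: norm_minus_cancel norm_one) (simp add: algebra_simps)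
  show "Re (v * (cinner h (A h) - cinner (B h) (P h))) \<le> (norm h)\<^sup>2 - (norm (P h))\<^sup>2"
    using a[OF v] b[of 1] b[of "-1"] by (simp only: norm_minus_cancel norm_one) (simp add: algebra_simps)
qed

lemma tetrablock_contraction_operators:
  assumes E: "tetrablock_contraction_on M A B P"
  shows "closed_csubspace M" "operator_on M A" "operator_on M B" "operator_on M P"
    "\<And>x. x \<in> M \<Longrightarrow> A (B x) = B (A x)" "\<And>x. x \<in> M \<Longrightarrow> A (P x) = P (A x)" "\<And>x. x \<in> M \<Longrightarrow> B (P x) = P (B x)"
  using E by (auto simp: tetrablock_contraction_on_def spectral_set_on_def commuting_triple_on_def)

lemma tetrablock_contraction_contractive:
  assumes E: "tetrablock_contraction_on UNIV A B P"
  shows "norm (P h) \<le> norm h"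
proof -
  let ?s = "cinner h (B h) - cinner (A h) (P h)"
  have "Re ?s \<le> (norm h)\<^sup>2 - (norm (P h))\<^sup>2" "- Re ?s \<le> (norm h)\<^sup>2 - (norm (P h))\<^sup>2"
    using tetrablock_contraction_form_le(1)[OF E, of 1 h]
      tetrablock_contraction_form_le(1)[OF E, of "-1" h] by simp_all
  then have "(norm (P h))\<^sup>2 \<le> (norm h)\<^sup>2" by linarith
  then show ?thesis by (rule power2_le_imp_le) simp
qed

section \<open>Adjoints on the isometric part\<close>

lemma eq_0_if_rotations_nonpos:
  assumes "\<And>v. cmod v = 1 \<Longrightarrow> Re (v * a) \<le> 0"
  shows "a = 0"
  using assms[of 1] assms[of "-1"] assms[of \<i>] assms[of "-\<i>"] by (auto simp: complex_eq_iff)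

lemma nonpos_if_le_small_multiples:
  fixes x y :: real
  assumes "\<And>t. t > 0 \<Longrightarrow> x \<le> t * y"
  shows "x \<le> 0"
proof (rule ccontr)
  assume x: "\<not> x \<le> 0"
  then have "y > 0" using assms[of 1] by simp
  then have "x \<le> x / 2" using assms[of "x / (2 * y)"] x by simp
  then show False using x by simp
qed

text \<open>All forms \<open>\<parallel>h\<parallel>\<^sup>2 - \<parallel>P h\<parallel>\<^sup>2 - Re (v s(h, h))\<close> are positive, and all are zero at a vector \<open>u\<close>
  with \<open>P\<^sup>*P u = u\<close>. A positive form has no cross terms with its null vectors, and the rotations
  \<open>v\<close> and \<open>k \<mapsto> \<i> k\<close> separate \<open>s(u, k)\<close> from \<open>s(k, u)\<close>.\<close>

lemma dominated_form_vanishes: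
  fixes P :: "'a::complex_hilbert \<Rightarrow> 'a" and s :: "'a \<Rightarrow> 'a \<Rightarrow> complex"
  assumes P: "operator_on UNIV P"
    and add: "\<And>x y z. s (x + y) z = s x z + s y z" "\<And>x y z. s x (y + z) = s x y + s x z"
    and scale: "\<And>c x y. s (c *\<^sub>C x) y = c * s x y" "\<And>c x y. s x (c *\<^sub>C y) = cnj c * s x y"
    and dom: "\<And>v h. cmod v = 1 \<Longrightarrow> Re (v * s h h) \<le> (norm h)\<^sup>2 - (norm (P h))\<^sup>2"
    and u: "adjoint_on UNIV P (P u) = u"
  shows "s u k = 0" "s k u = 0"
proof -
  have Re_comb: "Re (of_real t * a + of_real r * b) = t * Re a + r * Re b" for t r a b
    by simp
  have iso: "cinner (P u) (P k) = cinner u k" for k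
    using cinner_adjoint'[OF P, of "P u" k] u by simp
  then have nu: "(norm (P u))\<^sup>2 = (norm u)\<^sup>2"
    using iso[of u] by (simp only: cinner_self of_real_eq_iff)
  have suu: "s u u = 0"
    using dom[of _ u] nu by (intro eq_0_if_rotations_nonpos) simp
  have sym: "s u k + s k u = 0" for k
  proof (rule eq_0_if_rotations_nonpos)
    fix v :: complex assume v: "cmod v = 1"
    let ?x = "Re (v * (s u k + s k u))" and ?y = "(norm k)\<^sup>2 - (norm (P k))\<^sup>2 - Re (v * s k k)"
    have *: "?x \<le> t * ?y" if t: "t > 0" for t :: real
    proof -
      let ?h = "u + of_real t *\<^sub>C k"
      have "(norm (x + of_real t *\<^sub>C y))\<^sup>2 = (norm x)\<^sup>2 + t\<^sup>2 * (norm y)\<^sup>2 + 2 * t * Re (cinner x y)" for x y :: 'a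
        using norm_diff_square[of x "- (of_real t *\<^sub>C y)"]
        by (simp add: cinner_minus_right cinner_scaleC_right power_mult_distrib)
      then have "(norm ?h)\<^sup>2 - (norm (P ?h))\<^sup>2 = t\<^sup>2 * ((norm k)\<^sup>2 - (norm (P k))\<^sup>2)"
        using iso nu by (simp add: operator_onD(2,3)[OF P] algebra_simps)
      moreover have "v * s ?h ?h = of_real t * (v * (s u k + s k u)) + of_real (t\<^sup>2) * (v * s k k)"
        using suu by (simp add: add scale algebra_simps power2_eq_square)
      then have "Re (v * s ?h ?h) = t * ?x + t\<^sup>2 * Re (v * s k k)"
        by (simp only: Re_comb)
      ultimately have "t * ?x \<le> t * (t * ?y)"
        using dom[OF v, of ?h] by (simp add: algebra_simps power2_eq_square)
      then show ?thesis using t by simp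
    qed
    show "?x \<le> 0"
      using * by (rule nonpos_if_le_small_multiples)
  qed
  have "\<i> * (s k u - s u k) = 0"
    using sym[of "\<i> *\<^sub>C k"] by (simp add: scale algebra_simps)
  then show "s u k = 0" "s k u = 0"
    using sym[of k] by auto
qed

text \<open>The form is \<open>s(x, y) = \<langle>x, B y\<rangle> - \<langle>A x, P y\<rangle>\<close>; that \<open>s(k, u)\<close> and \<open>s(u, k)\<close> vanish
  for all \<open>k\<close> gives one identity each, and \<open>A\<close> and \<open>B\<close> may be exchanged.\<close>

lemma tetrablock_contraction_adjoints:
  assumes E: "tetrablock_contraction_on UNIV A B P" and u: "adjoint_on UNIV P (P u) = u"
  shows "B u = adjoint_on UNIV A (P u)" "adjoint_on UNIV B u = adjoint_on UNIV P (A u)"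
    "A u = adjoint_on UNIV B (P u)" "adjoint_on UNIV A u = adjoint_on UNIV P (B u)"
proof -
  note ops = tetrablock_contraction_operators[OF E]
  have gen: "Y u = adjoint_on UNIV X (P u) \<and> adjoint_on UNIV Y u = adjoint_on UNIV P (X u)"
    if X: "operator_on UNIV X" and Y: "operator_on UNIV Y"
      and dom: "\<And>v h. cmod v = 1 \<Longrightarrow>
        Re (v * (cinner h (Y h) - cinner (X h) (P h))) \<le> (norm h)\<^sup>2 - (norm (P h))\<^sup>2" for X Y
  proof -
    let ?s = "\<lambda>x y. cinner x (Y y) - cinner (X x) (P y)"
    have "?s u k = 0" "?s k u = 0" for k
      by (rule dominated_form_vanishes[where s = ?s, OF ops(4) _ _ _ _ dom u];
          simp add: operator_onD(2,3)[OF X] operator_onD(2,3)[OF Y] operator_onD(2,3)[OF ops(4)]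
            cinner_add_left cinner_add_right cinner_scaleC_left cinner_scaleC_right algebra_simps)+
    then have 1: "cinner u (Y k) = cinner (X u) (P k)" "cinner k (Y u) = cinner (X k) (P u)" for k
      by simp_all
    show ?thesis
    proof
      show "Y u = adjoint_on UNIV X (P u)"
        by (rule cinner_eqI) (simp add: 1 cinner_adjoint[OF X])
      show "adjoint_on UNIV Y u = adjoint_on UNIV P (X u)"
      proof (rule cinner_eqI)
        show "cinner z (adjoint_on UNIV Y u) = cinner z (adjoint_on UNIV P (X u))" for z
          using 1(1)[of z] by (metis cinner_adjoint[OF Y] cinner_adjoint[OF ops(4)] cinner_commute)
      qed
    qed
  qed
  show "B u = adjoint_on UNIV A (P u)" "adjoint_on UNIV B u = adjoint_on UNIV P (A u)"
    "A u = adjoint_on UNIV B (P u)" "adjoint_on UNIV A u = adjoint_on UNIV P (B u)"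
    using gen[OF ops(2,3) tetrablock_contraction_form_le(1)[OF E]]
      gen[OF ops(3,2) tetrablock_contraction_form_le(2)[OF E]] by auto
qed

section \<open>Restriction to reducing subspaces\<close>

lemma reduces_shift:
  assumes "reduces UNIV N T"
  shows "reduces UNIV N (\<lambda>x. T x - c *\<^sub>C x)"
  using assms closed_csubspaceD(4,5)[of N] closed_csubspaceD(4,5)[OF closed_csubspace_ortho[of N]]
  unfolding reduces_def by blast

lemma reduces_trans:
  assumes T: "operator_on UNIV T" and M: "reduces UNIV M T" and N: "reduces M N T"
  shows "reduces UNIV N T"
  unfolding reduces_def
proof (intro conjI ballI)
  fix x assume x: "x \<in> UNIV \<ominus> N"
  have Mc: "closed_csubspace M" and NM: "N \<subseteq> M" using M N by (auto simp: reduces_def)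
  let ?y = "orth_proj M x"
  have z: "x - ?y \<in> UNIV \<ominus> M" by (rule orth_proj(2)[OF Mc])
  then have "x - ?y \<in> UNIV \<ominus> N" using NM by (auto simp: ortho_diff_def)
  then have "x - (x - ?y) \<in> UNIV \<ominus> N"
    by (rule closed_csubspaceD(5)[OF closed_csubspace_ortho x])
  then have "?y \<in> M \<ominus> N" using orth_proj(1)[OF Mc, of x] by (simp add: ortho_diff_def)
  then have "T ?y \<in> UNIV \<ominus> N" using N by (auto simp: reduces_def ortho_diff_def)
  moreover have "T (x - ?y) \<in> UNIV \<ominus> N"
    using z M NM by (auto simp: reduces_def ortho_diff_def)
  ultimately have "T ?y + T (x - ?y) \<in> UNIV \<ominus> N"
    by (rule closed_csubspaceD(3)[OF closed_csubspace_ortho])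
  then show "T x \<in> UNIV \<ominus> N"
    using operator_on_diff[OF T closed_csubspace_UNIV, of x ?y] by simp
qed (use N in \<open>auto simp: reduces_def\<close>)

text \<open>The orthogonal projection onto \<open>N\<close> commutes with the operators, so it retracts the Koszul
  complex onto that of the restrictions and maps preimages to preimages in \<open>N\<close>.\<close>

lemma koszul_exact_on_reducing:
  assumes ops: "operator_on UNIV A" "operator_on UNIV B" "operator_on UNIV P"
    and red: "reduces UNIV N A" "reduces UNIV N B" "reduces UNIV N P"
    and exact: "koszul_exact_on UNIV A B P"
  shows "koszul_exact_on N A B P"
proof -
  define E where "E = orth_proj N"
  have N: "closed_csubspace N" using red by (simp add: reduces_def)
  have EN: "E x \<in> N" and Efix: "x \<in> N \<Longrightarrow> E x = x"
    and Eadd: "E (x + y) = E x + E y" and Ediff: "E (x - y) = E x - E y" for x y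
    by (simp_all add: E_def orth_proj[OF N] orth_proj_in[OF N] orth_proj_add[OF N] orth_proj_diff[OF N])
  have Ecomm: "A (E x) = E (A x)" "B (E x) = E (B x)" "P (E x) = E (P x)" for x
    by (simp_all add: E_def orth_proj_commute[OF ops(1) red(1)] orth_proj_commute[OF ops(2) red(2)]
        orth_proj_commute[OF ops(3) red(3)])
  have inv: "A x \<in> N" "B x \<in> N" "P x \<in> N" if "x \<in> N" for x
    using red that by (auto simp: reduces_def)
  have "0 \<in> N" using closed_csubspaceD(2)[OF N] .
  have e0: "{x. koszul0 A B P x = (0, 0, 0)} = {0}"
    and e1: "{t. koszul1 A B P t = (0, 0, 0)} = range (koszul0 A B P)"
    and e2: "{t. koszul2 A B P t = 0} = range (koszul1 A B P)"
    and e3: "UNIV = range (koszul2 A B P)"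
    using exact unfolding koszul_exact_on_def by simp_all
  have ex0: "koszul0 A B P x = (0, 0, 0) \<longleftrightarrow> x = 0" for x
    using e0 by (simp add: set_eq_iff)
  have ex1: "koszul1 A B P t = (0, 0, 0) \<longleftrightarrow> t \<in> range (koszul0 A B P)" for t
    by (simp only: e1[symmetric] mem_Collect_eq)
  have ex2: "koszul2 A B P t = 0 \<longleftrightarrow> t \<in> range (koszul1 A B P)" for t
    by (simp only: e2[symmetric] mem_Collect_eq)
  have ex3: "x \<in> range (koszul2 A B P)" for x
    by (simp only: e3[symmetric] UNIV_I)
  show ?thesis
    unfolding koszul_exact_on_def
  proof (intro conjI set_eqI iffI)
    fix t assume t: "t \<in> {t \<in> N \<times> N \<times> N. koszul1 A B P t = (0, 0, 0)}"
    then obtain w where w: "t = koszul0 A B P w" using ex1 by auto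
    have "t = koszul0 A B P (E w)"
      using t w by (auto simp: koszul0_def Ecomm Efix)
    then show "t \<in> koszul0 A B P ` N" using EN by blast
  next
    fix t assume t: "t \<in> {t \<in> N \<times> N \<times> N. koszul2 A B P t = 0}"
    then obtain x y z where w: "t = koszul1 A B P (x, y, z)" using ex2 by auto
    have "t = koszul1 A B P (E x, E y, E z)"
      using t w by (auto simp: koszul1_def Ecomm Ediff[symmetric] Efix)
    then show "t \<in> koszul1 A B P ` (N \<times> N \<times> N)" using EN by blast
  next
    fix t assume t: "t \<in> N"
    then obtain u v w where w: "t = koszul2 A B P (u, v, w)" using ex3[of t] by auto
    have "t = koszul2 A B P (E u, E v, E w)"
      using t w by (auto simp: koszul2_def Ecomm Ediff[symmetric] Eadd[symmetric] Efix)
    then show "t \<in> koszul2 A B P ` (N \<times> N \<times> N)" using EN by blast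
  next
    fix t assume "t \<in> koszul0 A B P ` N"
    then obtain x where "t = koszul0 A B P x" "x \<in> N" by blast
    then have "koszul1 A B P t = (0, 0, 0)" "t \<in> N \<times> N \<times> N"
      using ex1 inv by (blast, simp add: koszul0_def)
    then show "t \<in> {t \<in> N \<times> N \<times> N. koszul1 A B P t = (0, 0, 0)}" by blast
  next
    fix t assume "t \<in> koszul1 A B P ` (N \<times> N \<times> N)"
    then obtain x y z where t: "t = koszul1 A B P (x, y, z)" "x \<in> N" "y \<in> N" "z \<in> N" by blast
    then have "koszul2 A B P t = 0" using ex2 by blast
    moreover have "t \<in> N \<times> N \<times> N"
      using t inv closed_csubspaceD(5)[OF N] by (simp add: koszul1_def)
    ultimately show "t \<in> {t \<in> N \<times> N \<times> N. koszul2 A B P t = 0}" by blast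
  next
    fix t assume "t \<in> koszul2 A B P ` (N \<times> N \<times> N)"
    then show "t \<in> N"
      using inv closed_csubspaceD(3,5)[OF N] by (auto simp: koszul2_def)
  qed (use ex0 \<open>0 \<in> N\<close> in auto)
qed

lemma taylor_spectrum_on_reducing:
  assumes ops: "operator_on UNIV A" "operator_on UNIV B" "operator_on UNIV P"
    and red: "reduces UNIV N A" "reduces UNIV N B" "reduces UNIV N P"
  shows "taylor_spectrum_on N A B P \<subseteq> taylor_spectrum_on UNIV A B P"
  using koszul_exact_on_reducing[OF operator_on_shift[OF closed_csubspace_UNIV ops(1)]
      operator_on_shift[OF closed_csubspace_UNIV ops(2)] operator_on_shift[OF closed_csubspace_UNIV ops(3)]
      reduces_shift[OF red(1)] reduces_shift[OF red(2)] reduces_shift[OF red(3)]]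
  by (auto simp: taylor_spectrum_on_def)

lemma operator_on_reducing:
  "operator_on UNIV T \<Longrightarrow> reduces UNIV N T \<Longrightarrow> operator_on N T"
  by (rule operator_on_subset) (auto simp: reduces_def)

lemma inverse_invariant_if_reduces:
  assumes T: "operator_on UNIV T" "reduces UNIV N T"
    and S: "\<And>x. S (T x) = x \<and> T (S x) = x" and x: "x \<in> N"
  shows "S x \<in> N"
proof -
  have N: "closed_csubspace N" using T by (simp add: reduces_def)
  have "T (orth_proj N (S x)) = x"
    using orth_proj_commute[OF T, of "S x"] S orth_proj_in[OF N x] by simp
  then have "orth_proj N (S x) = S x" using S by metis
  then show ?thesis using orth_proj(1)[OF N, of "S x"] by simp
qed

text \<open>On a reducing subspace \<open>q(A, B, P)\<^sup>-\<^sup>1\<close> is the restriction of the inverse on the full space, so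
  norms of rational functions can only decrease.\<close>

lemma spectral_set_on_reducing:
  assumes X: "spectral_set_on X UNIV A B P"
    and red: "reduces UNIV N A" "reduces UNIV N B" "reduces UNIV N P"
  shows "spectral_set_on X N A B P"
proof -
  have ops: "operator_on UNIV A" "operator_on UNIV B" "operator_on UNIV P"
    and comm: "\<And>x. A (B x) = B (A x) \<and> A (P x) = P (A x) \<and> B (P x) = P (B x)"
    using X by (auto simp: spectral_set_on_def commuting_triple_on_def)
  have N: "closed_csubspace N" using red by (simp add: reduces_def)
  have opN: "operator_on K A" "operator_on K B" "operator_on K P" if "K = N \<or> K = UNIV \<ominus> N" for K
    using that red reduces_ortho operator_on_reducing ops by blast+
  have red_eval: "reduces UNIV N (eval3_op q A B P)" for q
    using operator_onD(1)[OF operator_on_eval3_op[OF N opN]]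
      operator_onD(1)[OF operator_on_eval3_op[OF closed_csubspace_ortho[of N] opN]] N
    by (auto simp: reduces_def)
  have "invertible_on N (eval3_op q A B P) \<and>
      onorm_on N (\<lambda>h. eval3_op p A B P (inv_into N (eval3_op q A B P) h))
        \<le> (SUP x\<in>X. norm (eval3 p x / eval3 q x))" if q: "\<forall>x\<in>X. eval3 q x \<noteq> 0" for p q
  proof -
    let ?p = "eval3_op p A B P" and ?q = "eval3_op q A B P"
    have ev: "operator_on UNIV ?p" "operator_on UNIV ?q"
      by (rule operator_on_eval3_op[OF closed_csubspace_UNIV ops])+
    obtain S where S: "operator_on UNIV S" "\<And>x. S (?q x) = x \<and> ?q (S x) = x"
      using X q unfolding spectral_set_on_def invertible_on_def by fastforce
    have SN: "operator_on N S"
      by (rule operator_on_subset[OF S(1)])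
        (simp_all add: inverse_invariant_if_reduces[OF ev(2) red_eval S(2)])
    have invN: "inv_into N ?q h = S h" if "h \<in> N" for h
      using inv_into_eq_inverse[OF SN _ that] S(2) by blast
    have invU: "inv_into UNIV ?q h = S h" for h
      using inv_into_eq_inverse[OF S(1)] S(2) by blast
    let ?r = "\<lambda>h. ?p (inv_into UNIV ?q h)"
    have op_r: "operator_on UNIV ?r"
      unfolding invU by (rule operator_on_compose[OF ev(1) S(1)])
    have "onorm_on N (\<lambda>h. ?p (inv_into N ?q h)) \<le> onorm_on UNIV ?r"
    proof (rule onorm_on_least)
      show "N \<noteq> {}" using closed_csubspaceD(2)[OF N] by blast
      show "0 \<le> onorm_on UNIV ?r" by (rule onorm_on_nonneg[OF op_r]) simp
      show "norm (?p (inv_into N ?q h)) \<le> onorm_on UNIV ?r * norm h" if "h \<in> N" for h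
        using onorm_on_le[OF op_r, of h] by (simp add: invN[OF that] invU)
    qed
    also have "\<dots> \<le> (SUP x\<in>X. norm (eval3 p x / eval3 q x))"
      using X q unfolding spectral_set_on_def by blast
    finally show ?thesis
      using SN S(2) unfolding invertible_on_def by blast
  qed
  moreover have "taylor_spectrum_on N A B P \<subseteq> X"
    using taylor_spectrum_on_reducing[OF ops red] X by (auto simp: spectral_set_on_def)
  moreover have "commuting_triple_on N A B P"
    using N opN comm by (simp add: commuting_triple_on_def)
  ultimately show ?thesis
    using X by (simp add: spectral_set_on_def)
qed

section \<open>Exactness of the Koszul complex of normal operators\<close>

text \<open>For \<open>t = \<delta> / K\<^sup>2\<close>, where \<open>K \<ge> \<delta>\<close> bounds \<open>G\<close>, the map \<open>x \<mapsto> x - t (G x - y)\<close> is a strict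
  contraction, since \<open>\<parallel>d - t G d\<parallel>\<^sup>2 \<le> (1 - 2 t \<delta> + t\<^sup>2 K\<^sup>2) \<parallel>d\<parallel>\<^sup>2\<close>.\<close>

lemma coercive_bijective:
  assumes M: "closed_csubspace M" and G: "operator_on M G"
    and d: "\<delta> > 0" "\<And>x. x \<in> M \<Longrightarrow> \<delta> * (norm x)\<^sup>2 \<le> x \<bullet> G x" and y: "y \<in> M"
  shows "\<exists>!x. x \<in> M \<and> G x = y"
proof -
  note MD = closed_csubspaceD[OF M]
  obtain K0 where K0: "K0 > 0" "\<And>x. x \<in> M \<Longrightarrow> norm (G x) \<le> K0 * norm x"
    using operator_on_bound[OF G] by blast
  define K where "K = max K0 \<delta>"
  have K: "K > 0" "\<delta> \<le> K" using K0 by (auto simp: K_def)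
  have GK: "norm (G x) \<le> K * norm x" if "x \<in> M" for x
    using K0(2)[OF that] mult_right_mono[of K0 K "norm x"] by (simp add: K_def)
  define t where "t = \<delta> / K\<^sup>2"
  define c where "c = sqrt (1 - (\<delta> / K)\<^sup>2)"
  have t: "t > 0" using d K by (simp add: t_def)
  have "(\<delta> / K)\<^sup>2 \<le> 1" "(\<delta> / K)\<^sup>2 > 0"
    using d(1) K power_le_one[of "\<delta> / K" 2] by (simp_all add: divide_le_eq)
  then have c: "0 \<le> c" "c < 1" and c2: "c\<^sup>2 = 1 - (\<delta> / K)\<^sup>2" by (auto simp: c_def)
  have const: "1 - 2 * t * \<delta> + t\<^sup>2 * K\<^sup>2 = c\<^sup>2"
  proof -
    have "t * \<delta> = (\<delta> / K)\<^sup>2" "t\<^sup>2 * K\<^sup>2 = (\<delta> / K)\<^sup>2"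
      using K by (simp_all add: t_def power2_eq_square)
    then show ?thesis by (simp add: c2 mult.assoc)
  qed
  let ?f = "\<lambda>x. x - t *\<^sub>R (G x - y)"
  have lip: "dist (?f x) (?f z) \<le> c * dist x z" if "x \<in> M" "z \<in> M" for x z
  proof -
    let ?d = "x - z"
    have dM: "?d \<in> M" using that MD by blast
    have square: "(norm (e - t *\<^sub>R g))\<^sup>2 = (norm e)\<^sup>2 - 2 * t * (e \<bullet> g) + t\<^sup>2 * (norm g)\<^sup>2" for e g :: 'a
      by (simp add: norm_diff_square Re_cinner power_mult_distrib)
    have "?f x - ?f z = ?d - t *\<^sub>R G ?d"
      by (simp add: operator_on_diff[OF G M that] algebra_simps)
    then have "(norm (?f x - ?f z))\<^sup>2 = (norm ?d)\<^sup>2 - 2 * t * (?d \<bullet> G ?d) + t\<^sup>2 * (norm (G ?d))\<^sup>2"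
      by (simp only: square)
    also have "\<dots> \<le> (norm ?d)\<^sup>2 - 2 * t * (\<delta> * (norm ?d)\<^sup>2) + t\<^sup>2 * (K * norm ?d)\<^sup>2"
      using d(2)[OF dM] GK[OF dM] t
      by (intro add_mono diff_mono mult_left_mono power_mono) auto
    also have "\<dots> = (1 - 2 * t * \<delta> + t\<^sup>2 * K\<^sup>2) * (norm ?d)\<^sup>2"
      by (simp add: algebra_simps power_mult_distrib)
    also have "\<dots> = (c * norm ?d)\<^sup>2"
      by (simp add: const power_mult_distrib)
    finally have "norm (?f x - ?f z) \<le> c * norm ?d"
      using c(1) by (rule power2_le_imp_le[OF _ mult_nonneg_nonneg]) simp
    then show ?thesis by (simp only: dist_norm)
  qed
  have "\<exists>!x\<in>M. ?f x = x"
  proof (rule Banach_fix[OF _ _ c _ lip])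
    show "complete M" using MD(1) by (simp add: complete_eq_closed)
    show "M \<noteq> {}" using MD(2) by blast
    show "?f ` M \<subseteq> M"
      using MD(5,7) operator_onD(1)[OF G] y by blast
  qed
  then show ?thesis using t by simp
qed

text \<open>If \<open>\<Sum> S\<^sub>i T\<^sub>i = I\<close> with \<open>S\<^sub>i\<close> commuting with the \<open>T\<^sub>j\<close>, then contraction of forms with
  \<open>(S\<^sub>1, S\<^sub>2, S\<^sub>3)\<close> is a homotopy from the identity of the Koszul complex to zero.\<close>

lemma koszul_exact_on_homotopy:
  assumes M: "closed_csubspace M"
    and T: "operator_on M T1" "operator_on M T2" "operator_on M T3"
    and comm: "\<And>x. x \<in> M \<Longrightarrow> T1 (T2 x) = T2 (T1 x)" "\<And>x. x \<in> M \<Longrightarrow> T1 (T3 x) = T3 (T1 x)"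
      "\<And>x. x \<in> M \<Longrightarrow> T2 (T3 x) = T3 (T2 x)"
    and S: "\<And>i x. i \<in> {1, 2, 3::nat} \<Longrightarrow> x \<in> M \<Longrightarrow> S i x \<in> M"
      "\<And>i x y. i \<in> {1, 2, 3} \<Longrightarrow> x \<in> M \<Longrightarrow> y \<in> M \<Longrightarrow> S i (x + y) = S i x + S i y"
      "\<And>i x. i \<in> {1, 2, 3} \<Longrightarrow> x \<in> M \<Longrightarrow> T1 (S i x) = S i (T1 x)"
      "\<And>i x. i \<in> {1, 2, 3} \<Longrightarrow> x \<in> M \<Longrightarrow> T2 (S i x) = S i (T2 x)"
      "\<And>i x. i \<in> {1, 2, 3} \<Longrightarrow> x \<in> M \<Longrightarrow> T3 (S i x) = S i (T3 x)"
    and unit: "\<And>x. x \<in> M \<Longrightarrow> S 1 (T1 x) + S 2 (T2 x) + S 3 (T3 x) = x"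
  shows "koszul_exact_on M T1 T2 T3"
proof -
  note MD = closed_csubspaceD[OF M]
  have Tin: "T1 x \<in> M" "T2 x \<in> M" "T3 x \<in> M" if "x \<in> M" for x
    using operator_onD(1)[OF T(1) that] operator_onD(1)[OF T(2) that] operator_onD(1)[OF T(3) that] .
  have Tadd: "T1 (x + y) = T1 x + T1 y" "T2 (x + y) = T2 x + T2 y" "T3 (x + y) = T3 x + T3 y"
    if "x \<in> M" "y \<in> M" for x y
    using operator_onD(2)[OF T(1) that] operator_onD(2)[OF T(2) that] operator_onD(2)[OF T(3) that] .
  have Tdiff: "T1 (x - y) = T1 x - T1 y" "T2 (x - y) = T2 x - T2 y" "T3 (x - y) = T3 x - T3 y"
    if "x \<in> M" "y \<in> M" for x y
    using operator_on_diff[OF T(1) M that] operator_on_diff[OF T(2) M that] operator_on_diff[OF T(3) M that] .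
  have T0: "T1 0 = 0" "T2 0 = 0" "T3 0 = 0"
    using operator_on_zero[OF T(1) M] operator_on_zero[OF T(2) M] operator_on_zero[OF T(3) M] .
  have Sin: "S 1 x \<in> M" "S 2 x \<in> M" "S 3 x \<in> M" if "x \<in> M" for x
    using S(1) that by auto
  have Sdiff: "S i (x - y) = S i x - S i y" if "i \<in> {1, 2, 3}" "x \<in> M" "y \<in> M" for i x y
    using S(2)[OF that(1) MD(5)[OF that(2,3)] that(3)] by simp
  have S0: "S i 0 = 0" if "i \<in> {1, 2, 3}" for i
    using Sdiff[OF that MD(2) MD(2)] by simp
  have TS: "T1 (S i x) = S i (T1 x)" "T2 (S i x) = S i (T2 x)" "T3 (S i x) = S i (T3 x)"
    if "i \<in> {1, 2, 3}" "x \<in> M" for i x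
    using S(3-5)[OF that] .
  show ?thesis
    unfolding koszul_exact_on_def
  proof (intro conjI set_eqI iffI)
    fix x assume "x \<in> {x \<in> M. koszul0 T1 T2 T3 x = (0, 0, 0)}"
    then show "x \<in> {0}"
      using unit[of x] S0 by (simp add: koszul0_def)
  next
    fix x :: 'a assume "x \<in> {0}"
    then show "x \<in> {x \<in> M. koszul0 T1 T2 T3 x = (0, 0, 0)}"
      using T0 MD(2) by (simp add: koszul0_def)
  next
    fix t assume "t \<in> {t \<in> M \<times> M \<times> M. koszul1 T1 T2 T3 t = (0, 0, 0)}"
    then obtain x y z where t: "t = (x, y, z)" and xM: "x \<in> M" "y \<in> M" "z \<in> M"
      and eq: "T1 y = T2 x" "T1 z = T3 x" "T2 z = T3 y"
      by (auto simp: koszul1_def)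
    let ?w = "S 1 x + S 2 y + S 3 z"
    note One_nat_def [simp del]
    note [simp] = xM Tin Sin MD(3) Tadd TS
    have "T1 ?w = x" using unit[OF xM(1)] eq by simp
    moreover have "T2 ?w = y" using unit[OF xM(2)] eq by simp
    moreover have "T3 ?w = z" using unit[OF xM(3)] eq by simp
    moreover have "?w \<in> M" by simp
    ultimately show "t \<in> koszul0 T1 T2 T3 ` M"
      unfolding t by (intro image_eqI[of _ _ ?w]) (simp_all only: koszul0_def)
  next
    fix t assume "t \<in> koszul0 T1 T2 T3 ` M"
    then show "t \<in> {t \<in> M \<times> M \<times> M. koszul1 T1 T2 T3 t = (0, 0, 0)}"
      using Tin comm by (auto simp: koszul0_def koszul1_def)
  next
    fix t assume "t \<in> {t \<in> M \<times> M \<times> M. koszul2 T1 T2 T3 t = 0}"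
    then obtain u v w where t: "t = (u, v, w)" and uM: "u \<in> M" "v \<in> M" "w \<in> M"
      and eq: "T1 w - T2 v + T3 u = 0"
      by (auto simp: koszul2_def)
    \<comment> \<open>The contraction of \<open>u e\<^sub>1\<and>e\<^sub>2 + v e\<^sub>1\<and>e\<^sub>3 + w e\<^sub>2\<and>e\<^sub>3\<close> with \<open>(S\<^sub>1, S\<^sub>2, S\<^sub>3)\<close>; the leading
      zero expresses negation by differences.\<close>
    let ?x = "0 - (S 2 u + S 3 v)" and ?y = "S 1 u - S 3 w" and ?z = "S 1 v + S 2 w"
    note One_nat_def [simp del]
    note [simp] = uM Tin Sin MD(2,3,5) Tadd Tdiff T0 TS
    have e1: "T1 w = T2 v - T3 u" using eq by (simp add: algebra_simps eq_neg_iff_add_eq_0)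
    have e2: "T2 v = T1 w + T3 u" and e3: "T1 w = T2 v - T3 u" using e1 by simp_all
    have "T1 ?y - T2 ?x = S 1 (T1 u) + S 2 (T2 u) + S 3 (T3 u)"
      by (simp add: e1 Sdiff del: diff_0)
    moreover have "T1 ?z - T3 ?x = S 1 (T1 v) + S 2 (T2 v) + S 3 (T3 v)"
      by (simp add: e2 S(2) del: diff_0)
    moreover have "T2 ?z - T3 ?y = S 1 (T1 w) + S 2 (T2 w) + S 3 (T3 w)"
      by (simp add: e3 Sdiff)
    ultimately have "koszul1 T1 T2 T3 (?x, ?y, ?z) = t"
      unfolding t koszul1_def prod.case by (simp only: unit uM)
    moreover have "(?x, ?y, ?z) \<in> M \<times> M \<times> M" by (simp del: diff_0)
    ultimately show "t \<in> koszul1 T1 T2 T3 ` (M \<times> M \<times> M)" by blast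
  next
    fix t assume "t \<in> koszul1 T1 T2 T3 ` (M \<times> M \<times> M)"
    then show "t \<in> {t \<in> M \<times> M \<times> M. koszul2 T1 T2 T3 t = 0}"
      using Tin comm MD(5) by (auto simp: koszul1_def koszul2_def Tdiff)
  next
    fix x assume xM: "x \<in> M"
    note One_nat_def [simp del]
    note [simp] = xM Tin Sin MD(2,3,5) Tadd Tdiff T0 TS
    have "x = koszul2 T1 T2 T3 (S 3 x, 0 - S 2 x, S 1 x)"
      using unit[OF xM] by (simp add: koszul2_def del: diff_0) simp
    moreover have "(S 3 x, 0 - S 2 x, S 1 x) \<in> M \<times> M \<times> M" by (simp del: diff_0)
    ultimately show "x \<in> koszul2 T1 T2 T3 ` (M \<times> M \<times> M)" by blast
  next
    fix x assume "x \<in> koszul2 T1 T2 T3 ` (M \<times> M \<times> M)"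
    then show "x \<in> M"
      using Tin MD(3,5) by (auto simp: koszul2_def)
  qed
qed

text \<open>When the tuple is bounded below, \<open>G = \<Sum> T\<^sub>i\<^sup>* T\<^sub>i\<close> is coercive, hence invertible, and
  \<open>S\<^sub>i = G\<^sup>-\<^sup>1 T\<^sub>i\<^sup>*\<close> solves \<open>\<Sum> S\<^sub>i T\<^sub>i = I\<close>; it commutes with the \<open>T\<^sub>j\<close> because the
  \<open>T\<^sub>i\<^sup>*\<close> do.\<close>

lemma koszul_exact_on_normal:
  fixes T1 T2 T3 :: "'a::complex_hilbert \<Rightarrow> 'a" and R :: "nat \<Rightarrow> 'a \<Rightarrow> 'a"
  assumes M: "closed_csubspace M"
    and T: "operator_on M T1" "operator_on M T2" "operator_on M T3"
    and R: "\<And>i. i \<in> {1, 2, 3} \<Longrightarrow> operator_on M (R i)"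
    and adj: "\<And>x y. x \<in> M \<Longrightarrow> y \<in> M \<Longrightarrow> cinner (T1 x) y = cinner x (R 1 y)"
      "\<And>x y. x \<in> M \<Longrightarrow> y \<in> M \<Longrightarrow> cinner (T2 x) y = cinner x (R 2 y)"
      "\<And>x y. x \<in> M \<Longrightarrow> y \<in> M \<Longrightarrow> cinner (T3 x) y = cinner x (R 3 y)"
    and comm: "\<And>x. x \<in> M \<Longrightarrow> T1 (T2 x) = T2 (T1 x)" "\<And>x. x \<in> M \<Longrightarrow> T1 (T3 x) = T3 (T1 x)"
      "\<And>x. x \<in> M \<Longrightarrow> T2 (T3 x) = T3 (T2 x)"
    and TR: "\<And>i x. i \<in> {1, 2, 3} \<Longrightarrow> x \<in> M \<Longrightarrow> T1 (R i x) = R i (T1 x)"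
      "\<And>i x. i \<in> {1, 2, 3} \<Longrightarrow> x \<in> M \<Longrightarrow> T2 (R i x) = R i (T2 x)"
      "\<And>i x. i \<in> {1, 2, 3} \<Longrightarrow> x \<in> M \<Longrightarrow> T3 (R i x) = R i (T3 x)"
    and below: "\<delta> > 0" "\<And>x. x \<in> M \<Longrightarrow> \<delta> * norm x \<le> norm (T1 x) + norm (T2 x) + norm (T3 x)"
  shows "koszul_exact_on M T1 T2 T3"
proof -
  define G where "G x = R 1 (T1 x) + R 2 (T2 x) + R 3 (T3 x)" for x
  have Rop: "operator_on M (R 1)" "operator_on M (R 2)" "operator_on M (R 3)" using R by auto
  have G: "operator_on M G"
    unfolding G_def[abs_def]
    by (rule operator_on_add[OF M operator_on_add[OF M operator_on_compose[OF Rop(1) T(1)]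
            operator_on_compose[OF Rop(2) T(2)]] operator_on_compose[OF Rop(3) T(3)]])
  have coer: "\<delta>\<^sup>2 / 3 * (norm x)\<^sup>2 \<le> x \<bullet> G x" if x: "x \<in> M" for x
  proof -
    let ?a = "norm (T1 x)" and ?b = "norm (T2 x)" and ?c = "norm (T3 x)"
    have "cinner x (G x) = of_real (?a\<^sup>2) + of_real (?b\<^sup>2) + of_real (?c\<^sup>2)"
      unfolding G_def cinner_add_right
      by (simp only: adj[symmetric] x operator_onD(1)[OF T(1)] operator_onD(1)[OF T(2)]
          operator_onD(1)[OF T(3)] cinner_self)
    then have "x \<bullet> G x = ?a\<^sup>2 + ?b\<^sup>2 + ?c\<^sup>2"
      by (simp add: Re_cinner[symmetric])
    moreover have "(\<delta> * norm x)\<^sup>2 \<le> (?a + ?b + ?c)\<^sup>2"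
      using below x by (intro power_mono) auto
    moreover have "(?a + ?b + ?c)\<^sup>2 \<le> 3 * (?a\<^sup>2 + ?b\<^sup>2 + ?c\<^sup>2)"
      using zero_le_power2[of "?a - ?b"] zero_le_power2[of "?a - ?c"] zero_le_power2[of "?b - ?c"]
      by (simp add: power2_eq_square algebra_simps)
    ultimately show ?thesis by (simp add: power_mult_distrib)
  qed
  have bij: "\<exists>!x. x \<in> M \<and> G x = y" if "y \<in> M" for y
    using coercive_bijective[OF M G _ coer that] below(1) by simp
  define W where "W y = (THE x. x \<in> M \<and> G x = y)" for y
  have W: "W y \<in> M" "G (W y) = y" if "y \<in> M" for y
    using theI'[OF bij[OF that]] by (auto simp: W_def)
  have WG: "W y = x" if "x \<in> M" "G x = y" for x y
    unfolding W_def using bij[of y] that operator_onD(1)[OF G] by (intro the1_equality) auto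
  have Wcomm: "T (W x) = W (T x)"
    if T: "operator_on M T" and TG: "\<And>x. x \<in> M \<Longrightarrow> G (T x) = T (G x)" and x: "x \<in> M" for T x
    using W[OF x] TG[of "W x"] operator_onD(1)[OF T] by (intro WG[symmetric]) auto
  have Tin: "T1 x \<in> M" "T2 x \<in> M" "T3 x \<in> M" if "x \<in> M" for x
    using operator_onD(1)[OF T(1) that] operator_onD(1)[OF T(2) that] operator_onD(1)[OF T(3) that] .
  have Rin: "R i x \<in> M" if "i \<in> {1, 2, 3}" "x \<in> M" for i x
    using operator_onD(1)[OF R] that by blast
  have Tadd: "T1 (x + y) = T1 x + T1 y" "T2 (x + y) = T2 x + T2 y" "T3 (x + y) = T3 x + T3 y"
    if "x \<in> M" "y \<in> M" for x y
    using operator_onD(2)[OF T(1) that] operator_onD(2)[OF T(2) that] operator_onD(2)[OF T(3) that] .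
  have TG: "G (T1 x) = T1 (G x)" "G (T2 x) = T2 (G x)" "G (T3 x) = T3 (G x)" if x: "x \<in> M" for x
    using x closed_csubspaceD(3)[OF M]
    by (simp_all add: G_def Tadd Tin Rin TR comm)
  show ?thesis
  proof (rule koszul_exact_on_homotopy[OF M T comm, of "\<lambda>i x. W (R i x)"])
    fix i :: nat and x y assume i: "i \<in> {1, 2, 3}" and x: "x \<in> M"
    note Rx = Rin[OF i x]
    show "W (R i x) \<in> M" using W(1)[OF Rx] .
    show "T1 (W (R i x)) = W (R i (T1 x))"
      using Wcomm[OF T(1) TG(1) Rx] TR(1)[OF i x] by simp
    show "T2 (W (R i x)) = W (R i (T2 x))"
      using Wcomm[OF T(2) TG(2) Rx] TR(2)[OF i x] by simp
    show "T3 (W (R i x)) = W (R i (T3 x))"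
      using Wcomm[OF T(3) TG(3) Rx] TR(3)[OF i x] by simp
  next
    fix i :: nat and x y assume i: "i \<in> {1, 2, 3}" and x: "x \<in> M" "y \<in> M"
    show "W (R i (x + y)) = W (R i x) + W (R i y)"
    proof (rule WG)
      show "W (R i x) + W (R i y) \<in> M"
        by (intro closed_csubspaceD(3)[OF M] W(1) Rin i x)
      show "G (W (R i x) + W (R i y)) = R i (x + y)"
        using operator_onD(2)[OF G W(1)[OF Rin[OF i x(1)]] W(1)[OF Rin[OF i x(2)]]]
          operator_onD(2)[OF R[OF i] x]
        by (simp only: W(2)[OF Rin[OF i x(1)]] W(2)[OF Rin[OF i x(2)]])
    qed
  next
    fix x assume x: "x \<in> M"
    note One_nat_def [simp del]
    have RT: "R 1 (T1 x) \<in> M" "R 2 (T2 x) \<in> M" "R 3 (T3 x) \<in> M"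
      using x by (auto intro!: Rin Tin)
    let ?w = "W (R 1 (T1 x)) + W (R 2 (T2 x)) + W (R 3 (T3 x))"
    have "?w \<in> M" by (intro closed_csubspaceD(3)[OF M] W(1) RT)
    moreover have "G ?w = G x"
      by (simp add: operator_onD(2)[OF G] closed_csubspaceD(3)[OF M] W RT) (simp add: G_def)
    ultimately show "?w = x"
      using bij[OF operator_onD(1)[OF G x]] x by blast
  qed simp_all
qed

section \<open>The canonical decomposition\<close>

text \<open>Since \<open>X\<close> commutes with \<open>P\<close> on the full space, one relation \<open>P\<^sup>*P X u = X u\<close> is enough:
  writing \<open>u = P v\<close> yields \<open>P\<^sup>* X u = P\<^sup>*P X v = X v = X P\<^sup>* u\<close>. So the image of the isometric part
  under \<open>X\<close> is stable under \<open>P\<close> and \<open>P\<^sup>*\<close>, which preserve norms on it.\<close>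

lemma isometric_part_commuting_invariant:
  fixes P :: "'a::complex_hilbert \<Rightarrow> 'a"
  assumes P: "operator_on UNIV P" and contr: "\<And>x. norm (P x) \<le> norm x"
    and comm: "\<And>x. X (P x) = P (X x)"
    and cancel: "\<And>u. u \<in> isometric_part P \<Longrightarrow> adjoint_on UNIV P (P (X u)) = X u"
    and u: "u \<in> isometric_part P"
  shows "adjoint_on UNIV P (X u) = X (adjoint_on UNIV P u)" "X u \<in> isometric_part P"
proof -
  let ?P' = "adjoint_on UNIV P" and ?U = "isometric_part P"
  note inv = isometric_part_invariant[OF P contr] and canc = isometric_part_adjoint_cancel[OF P contr]
  have adj: "?P' (X v) = X (?P' v)" if v: "v \<in> ?U" for v
    using cancel[OF inv(2)[OF v]] by (simp only: comm[symmetric] canc(2)[OF v])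
  show "?P' (X u) = X (?P' u)" by (rule adj[OF u])
  have "X ` ?U \<subseteq> ?U"
  proof (rule isometric_part_coinduct)
    fix x assume "x \<in> X ` ?U"
    then obtain v where v: "v \<in> ?U" and x: "x = X v" by blast
    have "P (?P' (X v)) = X v"
      by (simp only: adj[OF v] comm[symmetric] canc(2)[OF v])
    then have "norm (P (X v)) = norm (X v)" "norm (?P' (X v)) = norm (X v)"
      using cancel[OF v] norm_eq_iff_adjoint[OF P contr] by blast+
    moreover have "P (X v) \<in> X ` ?U"
      unfolding comm[symmetric] using inv(1)[OF v] by (rule imageI)
    moreover have "?P' (X v) \<in> X ` ?U"
      unfolding adj[OF v] using inv(2)[OF v] by (rule imageI)
    ultimately show "P x \<in> X ` ?U \<and> ?P' x \<in> X ` ?U \<and> norm (P x) = norm x \<and> norm (?P' x) = norm x"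
      unfolding x by blast
  qed
  then show "X u \<in> ?U" using u by blast
qed

text \<open>On the isometric part \<open>A = B\<^sup>* P\<close> and \<open>B\<^sup>* = P\<^sup>* A\<close> give, with \<open>A P = P A\<close>,
  \<open>P\<^sup>* P A u = P\<^sup>* A P u = B\<^sup>* P u = A u\<close>, and the same with \<open>A\<close> and \<open>B\<close> exchanged.\<close>

lemma tetrablock_contraction_isometric_part:
  assumes E: "tetrablock_contraction_on UNIV A B P" and X: "X \<in> {A, B}" and u: "u \<in> isometric_part P"
  shows "adjoint_on UNIV P (X u) = X (adjoint_on UNIV P u)" "X u \<in> isometric_part P"
proof -
  note ops = tetrablock_contraction_operators[OF E]
  note contr = tetrablock_contraction_contractive[OF E]
  note inv = isometric_part_invariant[OF ops(4) contr]
    and canc = isometric_part_adjoint_cancel[OF ops(4) contr]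
  note ids = tetrablock_contraction_adjoints[OF E canc(1)]
  have cancel: "adjoint_on UNIV P (P (X v)) = X v" if v: "v \<in> isometric_part P" for v
    using X ids(2,4)[OF inv(1)[OF v]] ids(1,3)[OF v] ops(6,7)[of v] by auto
  have comm: "X (P x) = P (X x)" for x
    using X ops(6,7) by auto
  note * = isometric_part_commuting_invariant[where X = X and P = P, OF ops(4) contr comm cancel u]
  show "adjoint_on UNIV P (X u) = X (adjoint_on UNIV P u)" by (rule *(1))
  show "X u \<in> isometric_part P" by (rule *(2))
qed

text \<open>Invariance under the adjoints is inherited from \<open>A\<^sup>* = P\<^sup>* B\<close> and \<open>B\<^sup>* = P\<^sup>* A\<close>.\<close>

lemma tetrablock_contraction_isometric_part_reduces:
  assumes E: "tetrablock_contraction_on UNIV A B P"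
  shows "reduces UNIV (isometric_part P) A" "reduces UNIV (isometric_part P) B"
proof -
  note ops = tetrablock_contraction_operators[OF E]
  note contr = tetrablock_contraction_contractive[OF E]
  note inv = isometric_part_invariant[OF ops(4) contr]
    and canc = isometric_part_adjoint_cancel[OF ops(4) contr]
  note ids = tetrablock_contraction_adjoints[OF E canc(1)]
  have AB: "A u \<in> isometric_part P" "B u \<in> isometric_part P" if "u \<in> isometric_part P" for u
    using tetrablock_contraction_isometric_part(2)[OF E _ that] by blast+
  have "adjoint_on UNIV A u \<in> isometric_part P" "adjoint_on UNIV B u \<in> isometric_part P"
    if u: "u \<in> isometric_part P" for u
    unfolding ids(2,4)[OF u] using inv(2) AB[OF u] by blast+
  then show "reduces UNIV (isometric_part P) A" "reduces UNIV (isometric_part P) B"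
    using AB isometric_part_closed_csubspace[OF ops(4) contr]
    by (simp_all add: reduces_UNIV_iff ops)
qed

text \<open>On the isometric part each of \<open>A\<close>, \<open>B\<close>, \<open>P\<close> commutes
  with \<open>P\<^sup>*\<close>, hence also with \<open>A\<^sup>* = P\<^sup>* B\<close> and \<open>B\<^sup>* = P\<^sup>* A\<close>.\<close>

lemma isometric_part_adjoints_commute:
  assumes E: "tetrablock_contraction_on UNIV A B P" and u: "u \<in> isometric_part P"
    and X: "X \<in> {A, B, P}" and Y: "Y \<in> {A, B, P}"
  shows "X (adjoint_on UNIV Y u) = adjoint_on UNIV Y (X u)"
proof -
  note ops = tetrablock_contraction_operators[OF E]
  note contr = tetrablock_contraction_contractive[OF E]
  note inv = isometric_part_invariant[OF ops(4) contr]
    and canc = isometric_part_adjoint_cancel[OF ops(4) contr]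
  note ids = tetrablock_contraction_adjoints[OF E canc(1)]
  have XU: "Z v \<in> isometric_part P" if "Z \<in> {A, B, P}" "v \<in> isometric_part P" for Z v
    using that tetrablock_contraction_isometric_part(2)[OF E _ that(2)] inv(1) by blast
  have XP: "X (adjoint_on UNIV P v) = adjoint_on UNIV P (X v)" if v: "v \<in> isometric_part P" for v
    using X tetrablock_contraction_isometric_part(1)[OF E _ v] canc[OF v] by fastforce
  have XA: "X (A v) = A (X v)" and XB: "X (B v) = B (X v)" for v
    using X ops(5-7) by auto
  have AU: "A u \<in> isometric_part P" and BU: "B u \<in> isometric_part P"
    using XU u by blast+
  have "X (adjoint_on UNIV A u) = adjoint_on UNIV A (X u)"
    unfolding ids(4)[OF u] ids(4)[OF XU[OF X u]] XP[OF BU] XB ..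
  moreover have "X (adjoint_on UNIV B u) = adjoint_on UNIV B (X u)"
    unfolding ids(2)[OF u] ids(2)[OF XU[OF X u]] XP[OF AU] XA ..
  ultimately show ?thesis using Y XP[OF u] by blast
qed

text \<open>The tuple \<open>(A - a, B - b, P - c)\<close> is bounded below on the isometric part when \<open>\<bar>c\<bar> \<noteq> 1\<close>,
  because \<open>P\<close> is isometric there, and when \<open>a \<noteq> cnj b * c\<close> and \<open>\<bar>c\<bar> = 1\<close>, because \<open>A = B\<^sup>* P\<close> gives
  \<open>a - cnj b * c = - (A - a) + B\<^sup>* (P - c) + c (B - b)\<^sup>*\<close>, where
  \<open>\<parallel>(B - b)\<^sup>* x\<parallel> = \<parallel>(B - b) x\<parallel>\<close> by normality. In both cases the Koszul complex is exact. The
  remaining condition \<open>\<bar>b\<bar> \<le> 1\<close> holds on the whole closed tetrablock, which contains the joint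
  spectrum on the full space and so that of the restriction.\<close>

lemma taylor_spectrum_on_isometric_part:
  assumes E: "tetrablock_contraction_on UNIV A B P"
  shows "taylor_spectrum_on (isometric_part P) A B P \<subseteq> distinguished_boundary"
proof
  fix x assume x: "x \<in> taylor_spectrum_on (isometric_part P) A B P"
  obtain a b c where abc: "x = (a, b, c)" by (metis prod_cases3)
  let ?U = "isometric_part P"
  note ops = tetrablock_contraction_operators[OF E]
  note contr = tetrablock_contraction_contractive[OF E]
  note inv = isometric_part_invariant[OF ops(4) contr]
    and canc = isometric_part_adjoint_cancel[OF ops(4) contr]
  note ids = tetrablock_contraction_adjoints[OF E canc(1)]
  note red = tetrablock_contraction_isometric_part_reduces[OF E] isometric_part_reduces[OF ops(4) contr]
  note U = isometric_part_closed_csubspace[OF ops(4) contr]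
  note opsU = operator_on_reducing[OF ops(2) red(1)] operator_on_reducing[OF ops(3) red(2)]
    operator_on_reducing[OF ops(4) red(3)]
  note adj_op = operator_on_adjoint[OF ops(2)] operator_on_adjoint[OF ops(3)] operator_on_adjoint[OF ops(4)]
  have adjU: "operator_on ?U (adjoint_on UNIV A)" "operator_on ?U (adjoint_on UNIV B)"
    "operator_on ?U (adjoint_on UNIV P)"
    using red unfolding reduces_UNIV_iff[OF ops(2)] reduces_UNIV_iff[OF ops(3)] reduces_UNIV_iff[OF ops(4)]
    by (auto intro: operator_on_subset[OF adj_op(1)] operator_on_subset[OF adj_op(2)]
        operator_on_subset[OF adj_op(3)])
  have "x \<in> taylor_spectrum_on UNIV A B P"
    using taylor_spectrum_on_reducing[OF ops(2-4) red] x by blast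
  then have "x \<in> closure tetrablock"
    using E by (auto simp: tetrablock_contraction_on_def spectral_set_on_def)
  then have b: "cmod b \<le> 1" using closure_tetrablock_bounds(2) abc by blast
  define T1 T2 T3 where T: "T1 = (\<lambda>x. A x - a *\<^sub>C x)" "T2 = (\<lambda>x. B x - b *\<^sub>C x)" "T3 = (\<lambda>x. P x - c *\<^sub>C x)"
  define R where "R i = (\<lambda>x. adjoint_on UNIV (if i = 1 then A else if i = 2 then B else P) x
      - cnj (if i = 1 then a else if i = 2 then b else c) *\<^sub>C x)" for i :: nat
  have R: "R 1 = (\<lambda>x. adjoint_on UNIV A x - cnj a *\<^sub>C x)" "R 2 = (\<lambda>x. adjoint_on UNIV B x - cnj b *\<^sub>C x)"
    "R 3 = (\<lambda>x. adjoint_on UNIV P x - cnj c *\<^sub>C x)"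
    by (simp_all add: R_def)
  have Tops: "operator_on ?U T1" "operator_on ?U T2" "operator_on ?U T3"
    unfolding T by (intro operator_on_shift[OF U] opsU)+
  have Rops: "operator_on ?U (R 1)" "operator_on ?U (R 2)" "operator_on ?U (R 3)"
    unfolding R by (intro operator_on_shift[OF U] adjU)+
  have shift_adj: "cinner (X x - z *\<^sub>C x) y = cinner x (adjoint_on UNIV X y - cnj z *\<^sub>C y)"
    if "operator_on UNIV X" for X z x y
    by (simp add: cinner_diff_left cinner_diff_right cinner_scaleC_left cinner_scaleC_right
        cinner_adjoint[OF that])
  have shift_comm: "X (Y x - z *\<^sub>C x) - w *\<^sub>C (Y x - z *\<^sub>C x) = Y (X x - w *\<^sub>C x) - z *\<^sub>C (X x - w *\<^sub>C x)"
    if "operator_on ?U X" "operator_on ?U Y" "x \<in> ?U" "X (Y x) = Y (X x)" for X Y x z w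
  proof -
    note [simp] = operator_onD(1)[OF that(1) that(3)] operator_onD(1)[OF that(2) that(3)] that(3,4)
      closed_csubspaceD(4)[OF U] operator_on_diff[OF that(1) U] operator_on_diff[OF that(2) U]
      operator_onD(3)[OF that(1)] operator_onD(3)[OF that(2)]
    show ?thesis by (simp add: scaleC_diff_right scaleC_scaleC mult.commute)
  qed
  have comm: "T1 (T2 x) = T2 (T1 x)" "T1 (T3 x) = T3 (T1 x)" "T2 (T3 x) = T3 (T2 x)" if "x \<in> ?U" for x
    unfolding T by (rule shift_comm; simp add: opsU that ops(5-7))+
  note adj_comm = isometric_part_adjoints_commute[OF E]
  have TR: "T1 (R 1 x) = R 1 (T1 x)" "T1 (R 2 x) = R 2 (T1 x)" "T1 (R 3 x) = R 3 (T1 x)"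
    "T2 (R 1 x) = R 1 (T2 x)" "T2 (R 2 x) = R 2 (T2 x)" "T2 (R 3 x) = R 3 (T2 x)"
    "T3 (R 1 x) = R 1 (T3 x)" "T3 (R 2 x) = R 2 (T3 x)" "T3 (R 3 x) = R 3 (T3 x)" if "x \<in> ?U" for x
    unfolding T R by (rule shift_comm; simp add: opsU adjU that adj_comm)+
  have not_below: False
    if d: "\<delta> > 0" and below: "\<And>x. x \<in> ?U \<Longrightarrow> \<delta> * norm x \<le> norm (T1 x) + norm (T2 x) + norm (T3 x)" for \<delta>
  proof -
    have "koszul_exact_on ?U T1 T2 T3"
    proof (rule koszul_exact_on_normal[where R = R, OF U Tops _ _ _ _ comm _ _ _ d below])
      show "operator_on ?U (R i)" if "i \<in> {1, 2, 3}" for i using that Rops by auto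
      show "cinner (T1 x) y = cinner x (R 1 y)" "cinner (T2 x) y = cinner x (R 2 y)"
        "cinner (T3 x) y = cinner x (R 3 y)" for x y
        unfolding T R by (rule shift_adj, fact ops)+
      show "T1 (R i x) = R i (T1 x)" "T2 (R i x) = R i (T2 x)" "T3 (R i x) = R i (T3 x)"
        if "i \<in> {1, 2, 3}" "x \<in> ?U" for i x
        using that(1) TR[OF that(2)] by auto
    qed
    then show False using x by (simp add: abc T taylor_spectrum_on_def)
  qed
  have c: "cmod c = 1"
  proof (rule ccontr)
    assume c: "cmod c \<noteq> 1"
    show False
    proof (rule not_below)
      show "\<bar>1 - cmod c\<bar> > 0" using c by simp
      fix x assume u: "x \<in> ?U"
      have "norm (P x) = norm x"
        using canc(1)[OF u] norm_eq_iff_adjoint(1)[OF ops(4) contr] by blast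
      then have "norm (P x) - norm (c *\<^sub>C x) = (1 - cmod c) * norm x"
        by (simp add: left_diff_distrib)
      then have "\<bar>1 - cmod c\<bar> * norm x = \<bar>norm (P x) - norm (c *\<^sub>C x)\<bar>"
        by (simp add: abs_mult)
      also have "\<dots> \<le> norm (T3 x)" unfolding T by (rule norm_triangle_ineq3)
      finally show "\<bar>1 - cmod c\<bar> * norm x \<le> norm (T1 x) + norm (T2 x) + norm (T3 x)"
        using norm_ge_zero[of "T1 x"] norm_ge_zero[of "T2 x"] by linarith
    qed
  qed
  have a: "a = cnj b * c"
  proof (rule ccontr)
    assume neq: "a \<noteq> cnj b * c"
    let ?B' = "adjoint_on UNIV B"
    obtain K where K: "K > 0" "\<And>x. norm (?B' x) \<le> K * norm x"
      using operator_on_bound[OF adj_op(2)] by auto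
    define L where "L = max 1 K"
    show False
    proof (rule not_below)
      show "cmod (a - cnj b * c) / L > 0" using neq by (simp add: L_def)
      fix x assume u: "x \<in> ?U"
      \<comment> \<open>The identity for \<open>A = B\<^sup>* P\<close>, with \<open>R 2 = (B - b)\<^sup>*\<close>.\<close>
      have "(a - cnj b * c) *\<^sub>C x = ?B' (T3 x) + c *\<^sub>C R 2 x - T1 x"
        using ids(3)[OF u]
        by (simp add: T R operator_on_diff[OF adj_op(2) closed_csubspace_UNIV] operator_onD(3)[OF adj_op(2)]
            scaleC_diff_left scaleC_diff_right scaleC_scaleC mult.commute)
      then have "cmod (a - cnj b * c) * norm x = norm (?B' (T3 x) + c *\<^sub>C R 2 x - T1 x)"
        by (metis norm_scaleC)
      also have "\<dots> \<le> norm (?B' (T3 x)) + norm (R 2 x) + norm (T1 x)"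
        using norm_triangle_ineq4[of "?B' (T3 x) + c *\<^sub>C R 2 x" "T1 x"]
          norm_triangle_ineq[of "?B' (T3 x)" "c *\<^sub>C R 2 x"] c by simp
      \<comment> \<open>A normal operator and its adjoint have the same norm at each vector.\<close>
      also have "norm (R 2 x) = norm (T2 x)"
      proof -
        have RU: "R 2 x \<in> ?U" and TU: "T2 x \<in> ?U"
          using operator_onD(1)[OF Rops(2) u] operator_onD(1)[OF Tops(2) u] .
        have adj2: "cinner (T2 y) z = cinner y (R 2 z)" for y z
          unfolding T R by (rule shift_adj[OF ops(3)])
        have "complex_of_real ((norm (T2 x))\<^sup>2) = cinner x (R 2 (T2 x))"
          by (simp only: cinner_self[symmetric] adj2)
        also have "\<dots> = cinner x (T2 (R 2 x))" by (simp only: TR(5)[OF u])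
        also have "\<dots> = cnj (cinner (T2 (R 2 x)) x)" by (rule cinner_commute)
        also have "\<dots> = of_real ((norm (R 2 x))\<^sup>2)"
          by (simp only: adj2 cinner_self complex_cnj_complex_of_real)
        finally have "(norm (T2 x))\<^sup>2 = (norm (R 2 x))\<^sup>2" by (simp only: of_real_eq_iff)
        then show ?thesis by simp
      qed
      also have "norm (?B' (T3 x)) + norm (T2 x) + norm (T1 x)
          \<le> L * norm (T3 x) + L * norm (T2 x) + L * norm (T1 x)"
      proof -
        have "K \<le> L" "1 \<le> L" by (auto simp: L_def)
        then have "K * norm (T3 x) \<le> L * norm (T3 x)" "1 * norm (T2 x) \<le> L * norm (T2 x)"
          "1 * norm (T1 x) \<le> L * norm (T1 x)"
          by (intro mult_right_mono; simp)+
        then show ?thesis using K(2)[of "T3 x"] by linarith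
      qed
      finally have "cmod (a - cnj b * c) * norm x \<le> (norm (T1 x) + norm (T2 x) + norm (T3 x)) * L"
        by (simp add: algebra_simps)
      moreover have "L > 0" by (simp add: L_def)
      ultimately show "cmod (a - cnj b * c) / L * norm x \<le> norm (T1 x) + norm (T2 x) + norm (T3 x)"
        by (simp add: pos_divide_le_eq)
    qed
  qed
  show "x \<in> distinguished_boundary"
    using a b c abc by (simp add: distinguished_boundary_def)
qed

lemma tetrablock_unitary_on_isometric_part:
  assumes E: "tetrablock_contraction_on UNIV A B P"
  shows "tetrablock_unitary_on (isometric_part P) A B P"
proof -
  note ops = tetrablock_contraction_operators[OF E]
  note contr = tetrablock_contraction_contractive[OF E]
  note red = tetrablock_contraction_isometric_part_reduces[OF E] isometric_part_reduces[OF ops(4) contr]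
  have normal: "normal_on (isometric_part P) X"
    if X: "X \<in> {A, B, P}" "operator_on UNIV X" "reduces UNIV (isometric_part P) X" for X
    unfolding normal_on_def
  proof (intro conjI ballI)
    show "operator_on (isometric_part P) X" by (rule operator_on_reducing[OF X(2,3)])
    fix u assume u: "u \<in> isometric_part P"
    then have "X u \<in> isometric_part P" using X(3) by (simp add: reduces_def)
    then show "adjoint_on (isometric_part P) X (X u) = X (adjoint_on (isometric_part P) X u)"
      using isometric_part_adjoints_commute[OF E u X(1) X(1)] u
      by (simp add: adjoint_on_reducing[OF X(2,3)])
  qed
  have "normal_on (isometric_part P) A" "normal_on (isometric_part P) B" "normal_on (isometric_part P) P"
    by (intro normal ops red; simp)+
  moreover have "commuting_triple_on (isometric_part P) A B P"
    unfolding commuting_triple_on_def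
    using isometric_part_closed_csubspace[OF ops(4) contr] ops(5-7)
      operator_on_reducing[OF ops(2) red(1)] operator_on_reducing[OF ops(3) red(2)]
      operator_on_reducing[OF ops(4) red(3)]
    by simp
  ultimately show ?thesis
    using taylor_spectrum_on_isometric_part[OF E] by (simp add: tetrablock_unitary_on_def)
qed

text \<open>A reducing subspace of the complement reduces \<open>P\<close> on the full space; if \<open>P\<close> is unitary on it,
  maximality puts it into the isometric part as well.\<close>

lemma completely_nonunitary_on_ortho:
  fixes P :: "'a::complex_hilbert \<Rightarrow> 'a"
  assumes P: "operator_on UNIV P" and contr: "\<And>x. norm (P x) \<le> norm x"
  shows "completely_nonunitary_on (UNIV \<ominus> isometric_part P) P"
  unfolding completely_nonunitary_on_def contraction_on_def
proof (intro conjI allI impI)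
  let ?H = "UNIV \<ominus> isometric_part P"
  note red = reduces_ortho[OF isometric_part_reduces[OF P contr]]
  show "operator_on ?H P" by (rule operator_on_reducing[OF P red])
  show "onorm_on ?H P \<le> 1"
    using closed_csubspaceD(2)[OF closed_csubspace_ortho] contr by (intro onorm_on_least) auto
  fix N assume N: "reduces ?H N P \<and> unitary_on N P"
  then have "reduces UNIV N P" using reduces_trans[OF P red] by blast
  then have "N \<subseteq> isometric_part P" using N isometric_part_maximal[OF P contr] by blast
  moreover have "N \<subseteq> ?H" "0 \<in> N" using N closed_csubspaceD(2) by (auto simp: reduces_def)
  ultimately show "N = {0}" using ortho_diff_self by blast
qed

theorem theorem3p1:
  fixes A B P :: "'a::complex_hilbert \<Rightarrow> 'a" and H1 H2 :: "'a set"
  assumes "tetrablock_contraction_on UNIV A B P"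
    and "H1 = unitary_part UNIV P"
    and "H2 = UNIV \<ominus> H1"
  shows "reduces UNIV H1 A \<and> reduces UNIV H1 B \<and> reduces UNIV H2 A \<and> reduces UNIV H2 B \<and>
    tetrablock_unitary_on H1 A B P \<and> cnu_tetrablock_contraction_on H2 A B P"
proof -
  note E = assms(1)
  note P = tetrablock_contraction_operators(4)[OF E]
  note contr = tetrablock_contraction_contractive[OF E]
  have H1: "H1 = isometric_part P"
    using assms(2) unitary_part_eq_isometric_part[OF P contr] by simp
  have red1: "reduces UNIV H1 A" "reduces UNIV H1 B" "reduces UNIV H1 P"
    using tetrablock_contraction_isometric_part_reduces[OF E] isometric_part_reduces[OF P contr]
    by (simp_all add: H1)
  then have red2: "reduces UNIV H2 A" "reduces UNIV H2 B" "reduces UNIV H2 P"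
    by (simp_all add: assms(3) reduces_ortho)
  have "tetrablock_contraction_on H2 A B P"
    using spectral_set_on_reducing[OF _ red2] E unfolding tetrablock_contraction_on_def by blast
  moreover have "completely_nonunitary_on H2 P"
    using completely_nonunitary_on_ortho[OF P contr] by (simp add: assms(3) H1)
  ultimately show ?thesis
    using red1 red2 tetrablock_unitary_on_isometric_part[OF E]
    by (simp add: cnu_tetrablock_contraction_on_def H1)
qed

end
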